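(* Fix real numbers $K>3$ and $\rho>2$, and let $y=y(x)$ be a function of $x$ satisfying $y=(\log x)^{K+o(1)}$ as $x\to\infty$. Put $\kappa=1/K$ and $\beta=(1-3\kappa)/4$, and suppose that \[ 1/2<\beta\rho<1\qquad\text{and}\qquad 2<\rho<2K+4. \] Then, as $x\to\infty$, \[ I_\rho(x,y)\le \Psi(x,y)^{1+o(1)}\left(x^{3(\rho-2)/4}+x^{(\rho-2)(1-\eta)}\right),\qquad\text{where}\quad \eta=\frac{\kappa(\rho-1)}{2+3\kappa\rho}. \]
   Context: For $0\le y\le x$, let $\mathcal S(x,y)$ be the set of integers $1\le n\le x$ all of whose prime factors $p$ satisfy $p\le y$ (the $y$-smooth numbers up to $x$), and $\Psi(x,y)=\#\mathcal S(x,y)$. For $\vartheta\in[0,1]$ let $S(\vartheta;x,y)=\sum_{n\in\mathcal S(x,y)}\mathbf e(\vartheta n)$, where $\mathbf e(s)=e^{2\pi i s}$, and for $\rho>2$ let $I_\rho(x,y)=\int_0^1|S(\vartheta;x,y)|^\rho\,d\vartheta$. Here $o(1)$ denotes a quantity tending to $0$ as $x\to\infty$ (possibly depending on $K$, $\rho$ and the function $y$); so the conclusion means that for every fixed $\varepsilon>0$ and all sufficiently large $x$ one has $I_\rho(x,y)\le \Psi(x,y)^{1+\varepsilon}(x^{3(\rho-2)/4}+x^{(\rho-2)(1-\eta)})$. *)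

theory Defs
  imports "HOL-Analysis.Analysis" "HOL-Computational_Algebra.Primes"
begin

definition smooth_set :: "real \<Rightarrow> real \<Rightarrow> nat set" where
  "smooth_set x y = {n. 1 \<le> n \<and> real n \<le> x \<and> (\<forall>p\<in>prime_factors n. real p \<le> y)}"

definition smooth_count :: "real \<Rightarrow> real \<Rightarrow> nat" where
  "smooth_count x y = card (smooth_set x y)"

definition add_char :: "real \<Rightarrow> complex" where
  "add_char s = exp (2 * complex_of_real pi * \<i> * complex_of_real s)"

definition smooth_exp_sum :: "real \<Rightarrow> real \<Rightarrow> real \<Rightarrow> complex" where
  "smooth_exp_sum \<theta> x y = (\<Sum>n\<in>smooth_set x y. add_char (\<theta> * real n))"

definition smooth_moment :: "real \<Rightarrow> real \<Rightarrow> real \<Rightarrow> real" where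
  "smooth_moment \<rho> x y = integral {0..1} (\<lambda>\<theta>. norm (smooth_exp_sum \<theta> x y) powr \<rho>)"

text \<open>
  This encodes \<open>y = (log x)^(K + o(1))\<close>, with \<open>\<delta>\<close> in the role of the \<open>o(1)\<close>.  It forces
  \<open>0 \<le> y x \<le> x\<close> for all large \<open>x\<close>, so that range condition is not imposed separately.
\<close>
definition log_power_growth :: "real \<Rightarrow> (real \<Rightarrow> real) \<Rightarrow> bool" where
  "log_power_growth K y \<longleftrightarrow>
     (\<exists>\<delta>::real \<Rightarrow> real. (\<delta> \<longlongrightarrow> 0) at_top \<and>
        (\<forall>\<^sub>F x in at_top. y x = ln x powr (K + \<delta> x)))"

end

theory Submission
  imports Defs "HOL-Real_Asymp.Real_Asymp"
begin

text \<open>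
  Write \<open>\<theta> = a / q + \<delta>\<close> with \<open>q\<close> at most about \<open>\<surd>x\<close> (Dirichlet) and put \<open>Q = q (1 + x \<bar>\<delta>\<bar>)\<close>, so \<open>Q \<le> 3 \<surd>x\<close>.
  Suppose \<open>\<Psi>(U, y) \<le> C U\<^sup>\<sigma>\<close> for all \<open>U > 0\<close>.  Factoring each smooth \<open>n\<close> as \<open>m k\<close> with \<open>m\<close> slightly larger
  than \<open>2 Q\<close>, applying Cauchy--Schwarz over all integers \<open>m\<close>, and counting smooth numbers in short
  progressions modulo \<open>q\<close>, one gets \<open>\<bar>S(\<theta>)\<bar> \<le> x\<^sup>\<sigma> Q powr (1/2 - \<sigma>)\<close> up to powers of \<open>C\<close>, \<open>y\<close> and \<open>log x\<close>.

  The trivial choice \<open>\<sigma> = 1\<close> gives \<open>\<bar>S(\<theta>)\<bar> \<le> x powr (1 + o(1)) / \<surd>Q\<close>.  Rankin's bound allows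
  \<open>\<sigma> = 1 - \<kappa> + o(1)\<close>, which gives \<open>\<bar>S(\<theta>)\<bar> \<le> x powr (1 - \<kappa> + o(1)) Q powr (-2 \<beta>)\<close>.  The first bound and
  Parseval treat \<open>Q > x powr (2 \<eta>)\<close>.  Since the \<open>\<theta>\<close> with \<open>Q \<le> Z\<close> have measure \<open>O(Z\<^sup>2 / x)\<close> and \<open>\<beta> \<rho> < 1\<close>, the second
  bound, applied on finitely many scales \<open>Z = x powr (j e)\<close>, treats the rest.  The exponent \<open>\<eta>\<close> balances the two parts,
  and the comparison with \<open>\<Psi>(x, y)\<close> uses the elementary lower bound \<open>\<Psi>(x, y) \<ge> x powr (1 - \<kappa> - o(1))\<close>.
\<close>

subsection \<open>Counting smooth numbers\<close>

text \<open>This is the route to a Chebyshev-type bound: with \<open>L\<close> the least common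
  multiple of 1, ..., n, every entry of row n of Pascal's triangle is at most \<open>L\<close>. In
  the induction step rows \<open>n\<close> and \<open>n - 1\<close> are both available for
  \<open>k\<close>, since the divisibility hypothesis on \<open>L\<close> passes to smaller
  rows.\<close>

lemma leibniz_triangle_dvd:
  fixes L n k :: nat
  assumes "\<And>i. 1 \<le> i \<Longrightarrow> i \<le> n \<Longrightarrow> i dvd L" and "1 \<le> k" and "k \<le> n"
  shows "k * (n choose k) dvd L"
  using assms(2,3,1)
proof (induction k arbitrary: n rule: dec_induct)
  case base
  then show ?case by simp
next
  case (step k)
  have "k * (n choose k) dvd L" and "k * ((n - 1) choose k) dvd L"
    using step by (auto intro!: step.IH)
  obtain a where a: "L = k * (n choose k) * a"
    using \<open>k * (n choose k) dvd L\<close> by (rule dvdE)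
  obtain b where b: "L = k * ((n - 1) choose k) * b"
    using \<open>k * ((n - 1) choose k) dvd L\<close> by (rule dvdE)
  txt \<open>The Leibniz triangle: \<open>1 / ((k + 1) (n choose k + 1)) = 1 / (k (n - 1 choose k)) - 1 / (k (n choose k))\<close>.\<close>
  let ?d = "(n - 1) choose k"
  have comp: "int (n - k) * int (n choose k) = int n * int ?d"
    using binomial_absorb_comp[of n k] by (metis of_nat_mult)
  have "int k * (int n * int ?d * (int b - int a))
        = int n * int L - int (n - k) * int L"
  proof -
    have 1: "int k * (int n * int ?d * int b) = int n * int L"
      by (subst b) simp
    have 2: "int k * (int n * int ?d * int a) = int (n - k) * int L"
      by (subst a, subst comp[symmetric]) (simp add: algebra_simps)
    show ?thesis
      by (metis 1 2 right_diff_distrib)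
  qed
  also have "\<dots> = int k * int L"
    using step by (simp add: of_nat_diff algebra_simps)
  finally have "int L = int n * int ?d * (int b - int a)"
    using step by simp
  then have "int (n * ?d) dvd int L" by simp
  then have "n * ?d dvd L" by (simp only: of_nat_dvd_iff)
  then show ?case
    using binomial_absorption[of k n] by simp
qed

text \<open>The number \<open>L\<close> in the proof is the least common multiple of 1, ..., n. Its
  prime powers are at most n, so \<open>L\<close> is at most n to the number of primes up to n; the
  n + 1 binomial coefficients of row n, each at most \<open>L\<close>, add up to 2^n.\<close>

lemma two_power_le_prime_count:
  fixes n :: nat
  assumes "n \<ge> 1"
  shows "2 ^ n \<le> (n + 1) * n ^ card {p. prime p \<and> p \<le> n}"
proof -
  let ?P = "{p. prime p \<and> p \<le> n}"
  have "\<exists>e. p ^ e \<le> n \<and> n < p ^ (e + 1)" if "p \<in> ?P" for p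
    using that assms prime_ge_2_nat[of p] by (intro ex_power_ivl1) auto
  then obtain e where e: "\<And>p. p \<in> ?P \<Longrightarrow> p ^ e p \<le> n \<and> n < p ^ (e p + 1)"
    by metis
  define L where "L = (\<Prod>p\<in>?P. p ^ e p)"
  have fin: "finite ?P" by simp
  have L0: "L > 0"
    unfolding L_def by (intro prod_pos) (auto simp: prime_gt_0_nat)
  have dvdL: "i dvd L" if i: "1 \<le> i" "i \<le> n" for i
  proof (rule multiplicity_le_imp_dvd)
    show "i \<noteq> 0" using i by simp
    fix p :: nat assume p: "prime p"
    show "multiplicity p i \<le> multiplicity p L"
    proof (cases "p \<le> n")
      case True
      have "p ^ multiplicity p i \<le> i"
        using i by (intro dvd_imp_le multiplicity_dvd) auto
      then have "p ^ multiplicity p i < p ^ (e p + 1)"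
        using e[of p] p True i by (auto intro: le_less_trans)
      then have "multiplicity p i \<le> e p"
        using prime_gt_1_nat[OF p] power_strict_increasing_iff by (metis Suc_eq_plus1 less_Suc_eq_le)
      moreover have "p ^ e p dvd L"
        unfolding L_def using fin p True by (intro dvd_prodI) auto
      then have "e p \<le> multiplicity p L"
        using L0 p by (intro multiplicity_geI) (auto simp: prime_gt_1_nat)
      ultimately show ?thesis by simp
    next
      case False
      then have "\<not> p dvd i" using i by (auto dest: dvd_imp_le)
      then show ?thesis by (simp add: not_dvd_imp_multiplicity_0)
    qed
  qed
  have "n choose k \<le> L" if "k \<le> n" for k
  proof (cases "k = 0")
    case False
    then have "(n choose k) dvd L"
      using leibniz_triangle_dvd[of n L k] dvdL that dvd_mult_right by auto
    then show ?thesis using L0 by (intro dvd_imp_le)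
  qed (use L0 in simp)
  then have "(\<Sum>k\<le>n. n choose k) \<le> (\<Sum>k\<le>n. L)"
    by (intro sum_mono) auto
  then have "2 ^ n \<le> (n + 1) * L"
    by (simp add: choose_row_sum)
  also have "L \<le> (\<Prod>p\<in>?P. n)"
    unfolding L_def using e by (intro prod_mono) auto
  then have "(n + 1) * L \<le> (n + 1) * n ^ card ?P"
    by (intro mult_le_mono) simp_all
  finally show ?thesis .
qed

section \<open>Elementary bounds for sets of smooth numbers\<close>

lemma finite_smooth_set [simp]: "finite (smooth_set x y)"
proof (rule finite_subset)
  show "smooth_set x y \<subseteq> {..nat \<lfloor>x\<rfloor>}"
    by (auto simp: smooth_set_def le_nat_floor)
qed simp

lemma smooth_set_iff:
  "n \<in> smooth_set x y \<longleftrightarrow> 1 \<le> n \<and> real n \<le> x \<and> (\<forall>p. prime p \<longrightarrow> p dvd n \<longrightarrow> real p \<le> y)"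
  by (auto simp: smooth_set_def in_prime_factors_iff)

lemma smooth_count_le:
  assumes "x \<ge> 0"
  shows "real (smooth_count x y) \<le> x"
proof -
  have "smooth_set x y \<subseteq> {1..nat \<lfloor>x\<rfloor>}"
    by (auto simp: smooth_set_def le_nat_floor)
  then have "card (smooth_set x y) \<le> nat \<lfloor>x\<rfloor>"
    using card_mono[of "{1..nat \<lfloor>x\<rfloor>}" "smooth_set x y"] by simp
  then show ?thesis unfolding smooth_count_def using assms by linarith
qed

text \<open>A product of \<open>u\<close> distinct primes up to \<open>y\<close> is smooth and at
  most \<open>y ^ u\<close>. Its set of prime factors gives back the chosen primes, so different
  choices give different products.\<close>

lemma smooth_count_ge_binomial:
  assumes "y \<ge> 1" and "y ^ u \<le> x"
  shows "card {p. prime p \<and> real p \<le> y} choose u \<le> smooth_count x y"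
proof -
  let ?P = "{p :: nat. prime p \<and> real p \<le> y}"
  have fin: "finite ?P"
    by (rule finite_subset[of _ "{..nat \<lfloor>y\<rfloor>}"]) (auto simp: le_nat_floor)
  have pf: "prime_factors (\<Prod>A) = A" if "A \<subseteq> ?P" for A :: "nat set"
  proof -
    have fA: "finite A" using that fin finite_subset by blast
    show ?thesis
    proof (intro equalityI subsetI)
      fix p assume "p \<in> prime_factors (\<Prod>A)"
      then have p: "prime p" "p dvd \<Prod>A" by (auto simp: in_prime_factors_iff)
      then obtain q where "q \<in> A" "p dvd q"
        using prime_dvd_prod_iff[OF fA p(1), of "\<lambda>x. x"] by auto
      then show "p \<in> A" using that p(1) primes_dvd_imp_eq by blast
    next
      fix p assume p: "p \<in> A"
      then have "p dvd \<Prod>A" using fA by (simp add: dvd_prod_eqI)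
      moreover have "\<Prod>A \<noteq> 0" using that fA by (auto simp: prod_zero_iff)
      ultimately show "p \<in> prime_factors (\<Prod>A)"
        using p that by (auto simp: in_prime_factors_iff)
    qed
  qed
  have "Prod ` {A. A \<subseteq> ?P \<and> card A = u} \<subseteq> smooth_set x y"
  proof safe
    fix A assume A: "A \<subseteq> ?P" "u = card A"
    have nz: "\<Prod>A \<noteq> 0" using A fin finite_subset by (subst prod_zero_iff) auto
    have "real (\<Prod>A) = (\<Prod>p\<in>A. real p)" by simp
    also have "\<dots> \<le> (\<Prod>p\<in>A. y)" using A by (intro prod_mono) auto
    also have "\<dots> \<le> x" using A assms(2) by simp
    finally have "real (\<Prod>A) \<le> x" .
    then show "\<Prod>A \<in> smooth_set x y"
      using nz pf[OF A(1)] A(1) unfolding smooth_set_def by auto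
  qed
  then have "card (Prod ` {A. A \<subseteq> ?P \<and> card A = u}) \<le> smooth_count x y"
    unfolding smooth_count_def by (intro card_mono) auto
  moreover have "inj_on Prod {A. A \<subseteq> ?P \<and> card A = u}"
    by (intro inj_onI) (metis (mono_tags, lifting) mem_Collect_eq pf)
  ultimately show ?thesis
    using n_subsets[OF fin, of u] by (simp add: card_image)
qed

text \<open>Adjoining a prime \<open>p\<close> to \<open>P\<close> changes the counting function \<open>F\<close> by \<open>F' U = F U + F' (U / p)\<close>.
  This gives Rankin's bound without summing a Dirichlet series.\<close>
lemma rankin_prime_set:
  fixes P :: "nat set" and \<sigma> U :: real
  assumes "finite P" and "\<And>p. p \<in> P \<Longrightarrow> prime p" and "\<sigma> > 0" and "U > 0"
  shows "real (card {n. 1 \<le> n \<and> real n \<le> U \<and> prime_factors n \<subseteq> P})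
           \<le> (\<Prod>p\<in>P. 1 / (1 - real p powr - \<sigma>)) * U powr \<sigma>"
  using assms(1,2,4)
proof (induction P arbitrary: U rule: finite_induct)
  case empty
  let ?A = "{n. 1 \<le> n \<and> real n \<le> U \<and> prime_factors n \<subseteq> {}}"
  show ?case
  proof (cases "U \<ge> 1")
    case True
    have "?A \<subseteq> {1}"
      by (auto simp: prime_factorization_empty_iff)
    then have "card ?A \<le> 1"
      using card_mono[of "{1::nat}" ?A] by simp
    then show ?thesis
      using ge_one_powr_ge_zero[of U \<sigma>] assms(3) True by simp
  next
    case False
    then have "?A = {}" by auto
    then show ?thesis by (simp only: card.empty) simp
  qed
next
  case (insert p P)
  have p: "prime p" using insert by auto
  define c where "c = (\<Prod>p\<in>P. 1 / (1 - real p powr - \<sigma>))"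
  define t where "t = real p powr - \<sigma>"
  define A where "A Q U = {n. 1 \<le> n \<and> real n \<le> U \<and> prime_factors n \<subseteq> Q}" for Q and U :: real
  have finA: "finite (A Q U)" for Q U
    by (rule finite_subset[of _ "{..nat \<lfloor>U\<rfloor>}"]) (auto simp: A_def le_nat_floor)
  have t: "0 < t" "t < 1"
    using prime_gt_1_nat[OF p] assms(3) by (auto simp: t_def powr_less_one)
  have rec: "card (A (insert p P) U) \<le> card (A P U) + card (A (insert p P) (U / p))" for U
  proof -
    have "A (insert p P) U \<subseteq> A P U \<union> (*) p ` A (insert p P) (U / p)"
    proof
      fix n assume n: "n \<in> A (insert p P) U"
      show "n \<in> A P U \<union> (*) p ` A (insert p P) (U / p)"
      proof (cases "p dvd n")
        case True
        then obtain m where m: "n = p * m" by (auto elim: dvdE)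
        have "prime_factors m \<subseteq> prime_factors n"
          using n m by (intro dvd_prime_factors) (auto simp: A_def)
        moreover have "1 \<le> m" using n m by (cases "m = 0") (auto simp: A_def)
        ultimately have "m \<in> A (insert p P) (U / p)"
          using n m prime_gt_0_nat[OF p] by (auto simp: A_def field_simps)
        then show ?thesis using m by blast
      next
        case False
        then have "p \<notin> prime_factors n" by (auto simp: in_prime_factors_iff)
        then show ?thesis using n by (auto simp: A_def)
      qed
    qed
    then have "card (A (insert p P) U) \<le> card (A P U \<union> (*) p ` A (insert p P) (U / p))"
      using finA by (intro card_mono) auto
    also have "\<dots> \<le> card (A P U) + card ((*) p ` A (insert p P) (U / p))"
      by (rule card_Un_le)
    also have "card ((*) p ` A (insert p P) (U / p)) \<le> card (A (insert p P) (U / p))"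
      using finA by (rule card_image_le)
    finally show ?thesis by simp
  qed
  have IH: "real (card (A P U)) \<le> c * U powr \<sigma>" if "U > 0" for U
    using insert.IH[of U] insert.prems that by (auto simp: A_def c_def)
  have c0: "c \<ge> 0" unfolding c_def
  proof (intro prod_nonneg ballI)
    fix q assume "q \<in> P"
    then have "real q powr - \<sigma> < 1"
      using insert.prems(1)[of q] prime_gt_1_nat[of q] assms(3) by (auto simp: powr_less_one)
    then show "0 \<le> 1 / (1 - real q powr - \<sigma>)" by simp
  qed
  \<comment> \<open>The recursion leads from \<open>U\<close> to \<open>U / p\<close> with p >= 2,
    so the induction runs over the dyadic size of \<open>U\<close>. It starts at U < 1, where no n
    is left. The constant d = c / (1 - t) solves c + t d = d.\<close>
  have "real (card (A (insert p P) U)) \<le> c / (1 - t) * U powr \<sigma>" if "U > 0" "U < 2 ^ k" for U k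
    using that
  proof (induction k arbitrary: U)
    case 0
    then have "A (insert p P) U = {}" by (auto simp: A_def)
    then show ?case using c0 t by simp
  next
    case (Suc k)
    have p2: "real p \<ge> 2" using prime_ge_2_nat[OF p] by simp
    have "U / p \<le> U / 2" using p2 Suc.prems by (intro divide_left_mono) auto
    also have "\<dots> < 2 ^ k" using Suc.prems by simp
    finally have Up: "U / p < 2 ^ k" "U / p > 0" using Suc.prems p2 by (auto simp del: divide_less_eq)
    have "real (card (A (insert p P) U)) \<le> real (card (A P U)) + real (card (A (insert p P) (U / p)))"
      using rec[of U] by linarith
    also have "\<dots> \<le> c * U powr \<sigma> + c / (1 - t) * (U / p) powr \<sigma>"
      using IH[OF Suc.prems(1)] Suc.IH[OF Up(2,1)] by linarith
    also have "(U / p) powr \<sigma> = U powr \<sigma> * t"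
      using p2 Suc.prems by (simp add: t_def powr_divide powr_minus field_simps)
    also have "c * U powr \<sigma> + c / (1 - t) * (U powr \<sigma> * t) = c / (1 - t) * U powr \<sigma>"
      using t by (simp add: field_simps)
    finally show ?case .
  qed
  moreover obtain k :: nat where "U < 2 ^ k"
    using real_arch_pow[of 2 U] by auto
  ultimately have "real (card (A (insert p P) U)) \<le> c / (1 - t) * U powr \<sigma>"
    using insert.prems by blast
  then show ?case
    using insert.hyps by (simp add: A_def c_def t_def)
qed

subsection \<open>Factoring smooth numbers\<close>

text \<open>A smooth number \<open>n > M\<close> is cut as \<open>n = m * k\<close> by multiplying its prime factors in increasing order until the
  product \<open>m\<close> exceeds \<open>M\<close>; \<open>p\<close> is the last prime taken.  For fixed \<open>p\<close> the admissible pairs \<open>(m, k)\<close>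
  form a product set, which is what the bilinear estimate needs.\<close>
definition heads :: "real \<Rightarrow> nat \<Rightarrow> nat set" where
  "heads M p = {m. 1 \<le> m \<and> p dvd m \<and> (\<forall>r. prime r \<longrightarrow> r dvd m \<longrightarrow> r \<le> p) \<and> M < real m \<and> real m \<le> M * real p}"

text \<open>The bound \<open>p \<le> s\<close> is not strict: when \<open>p\<close> is a repeated
  prime factor, the cut may leave further copies of it in \<open>k\<close>.\<close>

definition tails :: "nat \<Rightarrow> real \<Rightarrow> nat set" where
  "tails p y = {k. 1 \<le> k \<and> (\<forall>s. prime s \<longrightarrow> s dvd k \<longrightarrow> p \<le> s \<and> real s \<le> y)}"

text \<open>Among the divisors m > M of n whose primes do not exceed those of n / m, take the least;
  n itself is one of them. With p the largest prime of m, if m > M p then m / p would be a smaller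
  divisor of this kind.\<close>

lemma ex_head_tail:
  fixes n :: nat and M :: real
  assumes "n \<ge> 1" and "M \<ge> 1" and "real n > M"
  obtains p m k where "n = m * k" "prime p" "m \<in> heads M p" "\<And>s. prime s \<Longrightarrow> s dvd k \<Longrightarrow> p \<le> s"
proof -
  define good where "good m \<longleftrightarrow> m dvd n \<and> M < real m \<and>
      (\<forall>r s. prime r \<longrightarrow> r dvd m \<longrightarrow> prime s \<longrightarrow> s dvd n div m \<longrightarrow> r \<le> s)" for m
  have "good n" unfolding good_def using assms by auto
  define m where "m = (LEAST m. good m)"
  have gm: "good m" unfolding m_def using \<open>good n\<close> by (rule LeastI)
  have least: "m \<le> m'" if "good m'" for m' unfolding m_def using that by (rule Least_le)
  define k where "k = n div m"
  have n: "n = m * k" using gm by (simp add: good_def k_def)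
  have m1: "m \<noteq> 1" "m \<noteq> 0" using gm assms by (auto simp: good_def)
  define p where "p = Max (prime_factors m)"
  have ne: "prime_factors m \<noteq> {}"
    using m1 by (auto simp: prime_factorization_empty_iff)
  have "p \<in> prime_factors m" unfolding p_def using ne by (intro Max_in) auto
  then have p: "prime p" "p dvd m" by (auto simp: in_prime_factors_iff)
  have pmax: "r \<le> p" if "prime r" "r dvd m" for r
    unfolding p_def using that m1 by (intro Max_ge) (auto simp: in_prime_factors_iff)
  have ktail: "p \<le> s" if "prime s" "s dvd k" for s
    using gm p that by (auto simp: good_def k_def)
  have "real m \<le> M * real p"
  proof (rule ccontr)
    assume "\<not> real m \<le> M * real p"
    then have less: "M * real p < real m" by simp
    obtain m' where m': "m = p * m'" using p by (auto elim: dvdE)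
    have p0: "p > 0" using p prime_gt_0_nat by blast
    have m'0: "m' > 0" using m' m1 by (cases "m' = 0") auto
    have Mm': "M < real m'" using less p0 m' by (simp add: mult.commute)
    have div: "n div m' = p * k" using n m' m'0 by (simp add: algebra_simps)
    have "good m'" unfolding good_def div
    proof (intro conjI allI impI)
      show "m' dvd n" using n m' by simp
      show "M < real m'" by fact
      fix r s assume r: "prime r" "r dvd m'" and s: "prime s" "s dvd p * k"
      have "r \<le> p" using pmax r m' by auto
      moreover have "p \<le> s"
        using s p(1) ktail[of s] primes_dvd_imp_eq[of s p] by (auto simp: prime_dvd_mult_iff)
      ultimately show "r \<le> s" by simp
    qed
    then have "m \<le> m'" by (rule least)
    moreover have "p \<ge> 2" using p prime_ge_2_nat by blast
    ultimately show False using m' m'0 by (cases p) auto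
  qed
  then have "m \<in> heads M p"
    using m1 p pmax gm unfolding heads_def good_def by auto
  then show thesis using that n p ktail by blast
qed

text \<open>Both \<open>m\<close> and \<open>m'\<close> are initial segments of the same
  nondecreasing list of primes, so one contains the other. Otherwise some prime r occurs more often
  in \<open>m\<close> and some s more often in \<open>m'\<close>; then r divides \<open>k'\<close>
  and s divides \<open>k\<close>, which forces r = s.\<close>

lemma initial_divisor_chain:
  fixes m k m' k' :: nat
  assumes "m * k = m' * k'" and "m * k > 0"
    and "\<And>r s. prime r \<Longrightarrow> r dvd m \<Longrightarrow> prime s \<Longrightarrow> s dvd k \<Longrightarrow> r \<le> s"
    and "\<And>r s. prime r \<Longrightarrow> r dvd m' \<Longrightarrow> prime s \<Longrightarrow> s dvd k' \<Longrightarrow> r \<le> s"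
  shows "m dvd m' \<or> m' dvd m"
proof (rule ccontr)
  assume not: "\<not> (m dvd m' \<or> m' dvd m)"
  have nz: "m \<noteq> 0" "k \<noteq> 0" "m' \<noteq> 0" "k' \<noteq> 0"
    using assms(1,2) by (metis mult_0 mult_0_right less_irrefl)+
  obtain r where r: "prime r" "multiplicity r m > multiplicity r m'"
    using not nz multiplicity_le_imp_dvd[of m m'] by (meson not_le)
  obtain s where s: "prime s" "multiplicity s m' > multiplicity s m"
    using not nz multiplicity_le_imp_dvd[of m' m] by (meson not_le)
  have eq: "multiplicity t m + multiplicity t k = multiplicity t m' + multiplicity t k'"
    if "prime t" for t
    using that nz assms(1) prime_elem_multiplicity_mult_distrib[of t m k]
      prime_elem_multiplicity_mult_distrib[of t m' k'] by simp
  have dvd: "t dvd a" if "0 < multiplicity t a" for t a :: nat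
    using that not_dvd_imp_multiplicity_0 by fastforce
  have "r dvd m" "s dvd m'" using r s by (auto intro: dvd)
  moreover have "r dvd k'" using eq[OF r(1)] r by (intro dvd) simp
  moreover have "s dvd k" using eq[OF s(1)] s by (intro dvd) simp
  ultimately have "r \<le> s" "s \<le> r" using assms(3)[of r s] assms(4)[of s r] r s by auto
  then show False using r s by simp
qed

text \<open>If m' = m t with t > 1, then p' divides t: should p' divide m already, a prime s of t
  satisfies p' <= p <= s <= p'. Hence m' >= m p' > M p', against the upper bound for heads.\<close>

lemma head_tail_unique_aux:
  assumes "M \<ge> 1" and "prime p" "prime p'" and "m \<in> heads M p" "m' \<in> heads M p'"
    and "m * k = m' * k'" and "k \<in> tails p y" and "m dvd m'"
  shows "m = m'"
proof (rule ccontr)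
  assume ne: "m \<noteq> m'"
  obtain t where t: "m' = m * t" using assms(8) by (auto elim: dvdE)
  have m0: "m > 0" "m' > 0" using assms(4,5) by (auto simp: heads_def)
  have kt: "k = t * k'" using assms(6) t m0 by auto
  have "t \<noteq> 1" using ne t by auto
  then obtain s where s: "prime s" "s dvd t" using prime_factor_nat by blast
  have "s \<le> p'" using s t assms(5) by (auto simp: heads_def)
  have ps: "p \<le> s" using s kt assms(7) by (auto simp: tails_def)
  have "p' dvd t"
  proof (cases "p' dvd m")
    case True
    then have "p' \<le> p" using assms(3,4) by (auto simp: heads_def)
    then have "s = p'" using \<open>s \<le> p'\<close> ps by simp
    then show ?thesis using s by simp
  next
    case False
    have "p' dvd m * t" using assms(5) t by (auto simp: heads_def)
    then show ?thesis using False assms(3) by (auto simp: prime_dvd_mult_iff)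
  qed
  then obtain t' where t': "t = p' * t'" by (auto elim: dvdE)
  have "t' > 0" using m0 t t' by (cases "t' = 0") auto
  then have "m \<le> m * t'" by simp
  have "M * real p' < real m * real p'"
    using assms(4) prime_gt_0_nat[OF assms(3)] by (simp add: heads_def)
  also have "\<dots> \<le> real (m * t') * real p'"
    using \<open>m \<le> m * t'\<close> by (intro mult_right_mono) (simp_all only: of_nat_le_iff of_nat_0_le_iff)
  also have "\<dots> = real m'" using t t' by simp
  finally show False using assms(5) by (simp add: heads_def)
qed

text \<open>Comparability of the two heads reduces this to the case of one dividing the other, and
  \<open>p\<close> is recovered from \<open>m\<close> as its largest prime factor.\<close>

lemma head_tail_unique:
  assumes "M \<ge> 1" and "prime p" "prime p'" and "m \<in> heads M p" "m' \<in> heads M p'"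
    and "m * k = m' * k'" and "k \<in> tails p y" "k' \<in> tails p' y"
  shows "p = p' \<and> m = m' \<and> k = k'"
proof -
  have pos: "m > 0" "k > 0" using assms(4,7) by (auto simp: heads_def tails_def)
  have "r \<le> s" if "prime r" "r dvd m" "prime s" "s dvd k" for r s
    using that assms(4,7) unfolding heads_def tails_def by (blast intro: order_trans)
  moreover have "r \<le> s" if "prime r" "r dvd m'" "prime s" "s dvd k'" for r s
    using that assms(5,8) unfolding heads_def tails_def by (blast intro: order_trans)
  ultimately have "m dvd m' \<or> m' dvd m"
    by (intro initial_divisor_chain[OF assms(6)]) (blast | simp add: pos)+
  then have mm: "m = m'"
    using head_tail_unique_aux[OF assms(1,2,3,4,5,6,7)]
      head_tail_unique_aux[OF assms(1,3,2,5,4) assms(6)[symmetric] assms(8)] by auto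
  then have "k = k'" using assms(6) pos by simp
  moreover have "p = p'"
    using mm assms(2-5) unfolding heads_def by (auto intro: antisym)
  ultimately show ?thesis using mm by simp
qed

lemma finite_heads [simp]: "finite (heads M p)"
  by (rule finite_subset[of _ "{..nat \<lfloor>M * real p\<rfloor>}"]) (auto simp: heads_def le_nat_floor)

lemma finite_primes_le: "finite {p :: nat. prime p \<and> real p \<le> y}"
  by (rule finite_subset[of _ "{..nat \<lfloor>y\<rfloor>}"]) (auto simp: le_nat_floor)

lemma tails_le_subset_smooth_set: "{k \<in> tails p y. real k \<le> H} \<subseteq> smooth_set H y"
  by (auto simp: tails_def smooth_set_iff)

text \<open>Existence and uniqueness of the cut make multiplication a bijection from the admissible
  triples onto the smooth numbers in (M, x]. For fixed p only the condition m k <= x still couples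
  the two variables.\<close>

lemma sum_smooth_set_head_tail:
  fixes f :: "nat \<Rightarrow> 'a :: comm_monoid_add"
  assumes "M \<ge> 1"
  shows "(\<Sum>n | n \<in> smooth_set x y \<and> M < real n. f n) =
    (\<Sum>p | prime p \<and> real p \<le> y. \<Sum>m\<in>heads M p. \<Sum>k | k \<in> tails p y \<and> real (m * k) \<le> x. f (m * k))"
proof -
  let ?P = "{p :: nat. prime p \<and> real p \<le> y}"
  let ?K = "\<lambda>p m. {k. k \<in> tails p y \<and> real (m * k) \<le> x}"
  let ?N = "{n. n \<in> smooth_set x y \<and> M < real n}"
  define D where "D = Sigma ?P (\<lambda>p. Sigma (heads M p) (?K p))"
  have finK: "finite (?K p m)" if "m \<in> heads M p" for p m
  proof (rule finite_subset[OF _ finite_smooth_set])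
    have "real k \<le> real (m * k)" for k
      using that mult_right_mono[of 1 "real m" "real k"] by (simp add: heads_def)
    then show "?K p m \<subseteq> smooth_set x y"
      using tails_le_subset_smooth_set[of p y x] by (blast intro: order_trans)
  qed
  have bij: "bij_betw (\<lambda>(p, m, k). m * k) D ?N"
  proof (rule bij_betw_imageI)
    show "inj_on (\<lambda>(p, m, k). m * k) D"
    proof (rule inj_onI)
      fix u v
      assume uv: "u \<in> D" "v \<in> D" "(\<lambda>(p, m, k). m * k) u = (\<lambda>(p, m, k). m * k) v"
      obtain p m k where u: "u = (p, m, k)" by (cases u)
      obtain p' m' k' where v: "v = (p', m', k')" by (cases v)
      have eq: "m * k = m' * k'" using uv u v by simp
      have "p = p' \<and> m = m' \<and> k = k'"
        using uv(1,2) unfolding u v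
        by (intro head_tail_unique[OF assms _ _ _ _ eq, where y = y]) (simp_all add: D_def)
      then show "u = v" using u v by simp
    qed
    show "(\<lambda>(p, m, k). m * k) ` D = ?N"
    proof (intro equalityI subsetI)
      fix n assume "n \<in> (\<lambda>(p, m, k). m * k) ` D"
      then obtain p m k where n: "n = m * k" and p: "prime p" "real p \<le> y"
        and m: "m \<in> heads M p" and k: "k \<in> tails p y" and le: "real (m * k) \<le> x"
        unfolding D_def by auto
      have m0: "m \<ge> 1" "M < real m" using m by (auto simp: heads_def)
      have k0: "k \<ge> 1" using k by (auto simp: tails_def)
      have mn: "real m \<le> real n" using n k0 mult_left_mono[of 1 "real k" "real m"] by simp
      have "real s \<le> y" if "prime s" "s dvd n" for s
      proof -
        have "s dvd m \<or> s dvd k" using that n prime_dvd_mult_iff by blast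
        then consider "s dvd m" | "s dvd k" by blast
        then show ?thesis
        proof cases
          case 1
          then have "s \<le> p" using that m by (auto simp: heads_def)
          then show ?thesis using p by linarith
        qed (use that k in \<open>auto simp: tails_def\<close>)
      qed
      moreover have "M < real n" "1 \<le> n" using mn m0 by linarith+
      ultimately show "n \<in> ?N" using n le by (simp add: smooth_set_iff)
    next
      fix n assume n: "n \<in> ?N"
      then have n1: "n \<ge> 1" "real n > M" by (auto simp: smooth_set_iff)
      obtain p m k where h: "n = m * k" "prime p" "m \<in> heads M p"
          "\<And>s. prime s \<Longrightarrow> s dvd k \<Longrightarrow> p \<le> s"
        using ex_head_tail[OF n1(1) assms n1(2)] by metis
      have py: "real s \<le> y" if "prime s" "s dvd n" for s using n that by (auto simp: smooth_set_iff)
      have "p dvd n" using h by (auto simp: heads_def)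
      then have "real p \<le> y" using py h by blast
      moreover have "k \<in> tails p y"
        unfolding tails_def using h n1 py by (cases "k = 0") auto
      moreover have "real n \<le> x" using n by (simp add: smooth_set_iff)
      ultimately have "(p, m, k) \<in> D" unfolding D_def using h by auto
      then show "n \<in> (\<lambda>(p, m, k). m * k) ` D" using h(1) by force
    qed
  qed
  have "(\<Sum>n\<in>?N. f n) = (\<Sum>(p, m, k)\<in>D. f (m * k))"
    using sum.reindex_bij_betw[OF bij, of f] by (simp add: case_prod_unfold)
  also have "\<dots> = (\<Sum>p\<in>?P. \<Sum>(m, k)\<in>Sigma (heads M p) (?K p). f (m * k))"
    unfolding D_def using finite_primes_le finK by (subst sum.Sigma) auto
  also have "\<dots> = (\<Sum>p\<in>?P. \<Sum>m\<in>heads M p. \<Sum>k\<in>?K p m. f (m * k))"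
    using finK by (intro sum.cong refl, subst sum.Sigma) auto
  finally show ?thesis .
qed

subsection \<open>Smooth numbers in short progressions\<close>

lemma card_separated_le:
  fixes A :: "nat set" and d :: nat and Z T :: real
  assumes "d \<ge> 1" and "T \<ge> 0" and "finite A"
    and "\<And>k. k \<in> A \<Longrightarrow> Z \<le> real k \<and> real k \<le> Z + T"
    and "\<And>k l. k \<in> A \<Longrightarrow> l \<in> A \<Longrightarrow> int d dvd int k - int l"
  shows "real (card A) \<le> T / real d + 1"
proof (cases "A = {}")
  case False
  define a where "a = Min A"
  have a: "a \<in> A" "\<And>k. k \<in> A \<Longrightarrow> a \<le> k" using assms(3) False by (auto simp: a_def)
  have dvd: "d dvd k - a" if "k \<in> A" for k
  proof -
    have "int d dvd int (k - a)" using assms(5)[OF that a(1)] a(2)[OF that] by (simp add: of_nat_diff)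
    then show ?thesis by (simp only: of_nat_dvd_iff)
  qed
  have "inj_on (\<lambda>k. (k - a) div d) A"
  proof (rule inj_onI)
    fix k l assume kl: "k \<in> A" "l \<in> A" "(k - a) div d = (l - a) div d"
    then have "k - a = l - a" using dvd assms(1) by (metis dvd_div_mult_self)
    then show "k = l" using a(2) kl by (metis eq_diff_iff)
  qed
  moreover have "(\<lambda>k. (k - a) div d) ` A \<subseteq> {..nat \<lfloor>T / d\<rfloor>}"
  proof safe
    fix k assume k: "k \<in> A"
    have "real ((k - a) div d) \<le> real (k - a) / real d"
      by (rule of_nat_div_le_of_nat)
    also have "\<dots> \<le> T / d"
      using assms(4)[OF k] assms(4)[OF a(1)] a(2)[OF k] by (intro divide_right_mono) auto
    finally show "(k - a) div d \<le> nat \<lfloor>T / d\<rfloor>" by (simp add: le_nat_floor)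
  qed
  ultimately have "card A \<le> card {..nat \<lfloor>T / d\<rfloor>}"
    by (metis card_image card_mono finite_atMost)
  moreover have "T / d \<ge> 0" using assms by simp
  ultimately show ?thesis by simp linarith
qed (use assms in simp)

text \<open>Take the largest divisor m of k not exceeding U. Since k > U, the cofactor has a prime
  factor p <= y, and m p > U by maximality.\<close>

lemma ex_divisor_in_range:
  fixes k :: nat and U y :: real
  assumes "1 \<le> U" and "U < real k" and "y > 0"
    and "\<And>p. prime p \<Longrightarrow> p dvd k \<Longrightarrow> real p \<le> y"
  obtains m where "m dvd k" "1 \<le> m" "real m \<le> U" "U < real m * y"
proof -
  define m where "m = Max {d. d dvd k \<and> real d \<le> U}"
  have k0: "k > 0" using assms(1,2) by (cases k) auto
  have fin: "finite {d. d dvd k \<and> real d \<le> U}"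
    by (rule finite_subset[of _ "{d. d dvd k}"]) (use k0 in auto)
  have "1 \<in> {d. d dvd k \<and> real d \<le> U}" using assms by auto
  then have "m \<in> {d. d dvd k \<and> real d \<le> U}"
    unfolding m_def using fin Max_in by blast
  then have m: "m dvd k" "real m \<le> U" by auto
  obtain t where t: "k = m * t" using m by (auto elim: dvdE)
  have m0: "m > 0" using t k0 by (cases m) auto
  have "t \<noteq> 1" using t m assms by auto
  then obtain p where p: "prime p" "p dvd t" using prime_factor_nat by blast
  have "U < real (m * p)"
  proof (rule ccontr)
    assume "\<not> U < real (m * p)"
    then have "m * p \<in> {d. d dvd k \<and> real d \<le> U}" using t p by auto
    then have "m * p \<le> m" unfolding m_def using fin by (intro Max_ge)
    then show False using m0 prime_ge_2_nat[OF p(1)] by simp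
  qed
  also have "\<dots> \<le> real m * y" using assms(4)[OF p(1)] p t by (simp add: mult_left_mono)
  finally show thesis using that[of m] m m0 by auto
qed

text \<open>Every large element \<open>k\<close> of the progression has a divisor \<open>m\<close> of size about \<open>U = 1 + T / q\<close>, coprime to the
  modulus once \<open>gcd k q\<close> is divided out, and \<open>m\<close> leaves only \<open>O(y)\<close> choices for \<open>k\<close>.\<close>
lemma card_smooth_progression_le:
  fixes K :: "nat set" and q :: nat and C \<sigma> y Z T :: real
  assumes bound: "\<And>U. U > 0 \<Longrightarrow> real (card (smooth_set U y)) \<le> C * U powr \<sigma>"
    and "y \<ge> 1" and "q \<ge> 1" and "T \<ge> 0" and "finite K"
    and K: "\<And>k. k \<in> K \<Longrightarrow> 1 \<le> k \<and> Z \<le> real k \<and> real k \<le> Z + T"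
    and smooth: "\<And>k p. k \<in> K \<Longrightarrow> prime p \<Longrightarrow> p dvd k \<Longrightarrow> real p \<le> y"
    and cong: "\<And>k l. k \<in> K \<Longrightarrow> l \<in> K \<Longrightarrow> int q dvd int k - int l"
  shows "real (card K) \<le> (y + 2) * C * (1 + T / q) powr \<sigma>"
proof -
  define U where "U = 1 + T / q"
  have U1: "U \<ge> 1" unfolding U_def using assms by simp
  have CU: "real (card (smooth_set U y)) \<le> C * U powr \<sigma>" using bound U1 by simp
  show ?thesis
  proof (cases "K = {}")
    case True
    have "0 \<le> C * U powr \<sigma>" using CU by (meson of_nat_0_le_iff order_trans)
    then show ?thesis using True assms(2) by (simp add: U_def[symmetric] mult.assoc)
  next
    case False
    then obtain k0 where k0: "k0 \<in> K" by auto
    define g where "g = gcd k0 q"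
    have g0: "g > 0" using assms(3) by (simp add: g_def)
    \<comment> \<open>All elements of a residue class modulo q share the same gcd with q, so the
      same \<open>g\<close> can be divided out of every k.\<close>
    have gk: "gcd k q = g" if "k \<in> K" for k
    proof -
      have "int q dvd int k - int k0" using cong[OF that k0] .
      then obtain c where c: "int k - int k0 = int q * c" by (rule dvdE)
      have "gcd (int k) (int q) = gcd (int k0) (int q)"
        using c gcd_add_mult[of "int q" c "int k0"]
        by (metis add.commute diff_add_cancel gcd.commute mult.commute)
      then show ?thesis by (simp add: g_def gcd_int_int_eq)
    qed
    define q' where "q' = q div g"
    have q: "q = g * q'" by (simp add: q'_def g_def)
    have kg: "k = g * (k div g)" if "k \<in> K" for k
      using gk[OF that] by (metis dvd_mult_div_cancel gcd_dvd1)
    have kdg: "1 \<le> k div g" if "k \<in> K" for k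
      using kg[OF that] K[OF that] by (metis One_nat_def Suc_leI gr0I mult_0_right not_one_le_zero)
    have cop: "coprime (k div g) q'" if "k \<in> K" for k
      unfolding q'_def using div_gcd_coprime[of k q] gk[OF that] assms(3) by auto
    define S where "S = {k \<in> K. real (k div g) \<le> U}"
    define B where "B m = {k \<in> K. g * m dvd k}" for m
    define MM where "MM = {m \<in> smooth_set U y. U < real m * y}"
    have cover: "K \<subseteq> S \<union> (\<Union>m\<in>MM. B m)"
    proof
      fix k assume k: "k \<in> K"
      show "k \<in> S \<union> (\<Union>m\<in>MM. B m)"
      proof (cases "real (k div g) \<le> U")
        case False
        have sm: "real p \<le> y" if "prime p" "p dvd k div g" for p
          using smooth[OF k that(1)] that(2) kg[OF k] by (metis dvd_mult)
        obtain m where m: "m dvd k div g" "1 \<le> m" "real m \<le> U" "U < real m * y"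
          using ex_divisor_in_range[of U "k div g" y] False U1 assms(2) sm by auto
        have "m \<in> MM"
          unfolding MM_def smooth_set_iff using m sm dvd_trans by blast
        moreover have "k \<in> B m"
          unfolding B_def using k m(1) kg[OF k] by (metis (no_types, lifting) mem_Collect_eq mult_dvd_mono dvd_refl)
        ultimately show ?thesis by blast
      qed (use k in \<open>simp add: S_def\<close>)
    qed
    have "(\<lambda>k. k div g) ` S \<subseteq> smooth_set U y"
    proof safe
      fix k assume "k \<in> S"
      then have k: "k \<in> K" "real (k div g) \<le> U" by (auto simp: S_def)
      then show "k div g \<in> smooth_set U y"
        unfolding smooth_set_iff using kdg[OF k(1)] smooth[OF k(1)] kg[OF k(1)] by (metis dvd_mult)
    qed
    moreover have "inj_on (\<lambda>k. k div g) S"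
      by (rule inj_onI) (metis (no_types, lifting) S_def kg mem_Collect_eq)
    ultimately have cS: "card S \<le> card (smooth_set U y)"
      by (metis card_image card_mono finite_smooth_set)
    have cB: "real (card (B m)) \<le> y + 1" if "m \<in> MM" for m
    proof -
      have m: "1 \<le> m" "U < real m * y" using that by (auto simp: MM_def smooth_set_iff)
      \<comment> \<open>Here m divides the quotients by g and is coprime to \<open>q'\<close>, so
        elements of \<open>B m\<close> agree modulo g m q' = m q. They lie in an interval of length
        T, and T / (m q) <= U / m <= y.\<close>
      have "real (card (B m)) \<le> T / real (m * q) + 1"
      proof (rule card_separated_le)
        show "1 \<le> m * q" using m assms(3) by simp
        show "finite (B m)" using assms(5) by (simp add: B_def)
        show "Z \<le> real k \<and> real k \<le> Z + T" if "k \<in> B m" for k using K that by (auto simp: B_def)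
        fix k l assume kl: "k \<in> B m" "l \<in> B m"
        then have kK: "k \<in> K" "l \<in> K" by (auto simp: B_def)
        have mk: "m dvd k div g" "m dvd l div g"
          using kl g0 kg[OF kK(1)] kg[OF kK(2)] unfolding B_def
          by (metis (no_types, lifting) mem_Collect_eq dvd_mult_cancel1 nat_mult_dvd_cancel_disj not_gr_zero)+
        define e where "e = int (k div g) - int (l div g)"
        have eq: "int k - int l = int g * e"
          using kg[OF kK(1)] kg[OF kK(2)] unfolding e_def by (metis of_nat_mult right_diff_distrib)
        have 1: "int m dvd e" unfolding e_def using mk by (intro dvd_diff) (simp_all only: of_nat_dvd_iff)
        have "int g * int q' dvd int g * e" using cong[OF kK] q eq by (metis of_nat_mult)
        then have 2: "int q' dvd e" using g0 by simp
        have "coprime m q'" using cop[OF kK(1)] mk(1) coprime_divisors dvd_refl by blast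
        then have "coprime (int m) (int q')" by simp
        then have "int m * int q' dvd e" using 1 2 by (intro divides_mult)
        then have "int g * (int m * int q') dvd int g * e" by (rule mult_dvd_mono[OF dvd_refl])
        then show "int (m * q) dvd int k - int l"
          unfolding eq q by (simp add: algebra_simps)
      qed (use assms in simp)
      also have "T / real (m * q) \<le> U / real m"
        using assms(3,4) m unfolding U_def by (simp add: field_simps)
      also have "U / real m \<le> y" using m by (simp add: field_simps)
      finally show ?thesis by simp
    qed
    have finMM: "finite MM" by (simp add: MM_def)
    have "card K \<le> card (S \<union> (\<Union>m\<in>MM. B m))"
      using cover finMM assms(5) by (intro card_mono) (auto simp: S_def B_def)
    also have "\<dots> \<le> card S + card (\<Union>m\<in>MM. B m)" by (rule card_Un_le)
    also have "card (\<Union>m\<in>MM. B m) \<le> (\<Sum>m\<in>MM. card (B m))" by (rule card_UN_le[OF finMM])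
    finally have "real (card K) \<le> real (card S) + (\<Sum>m\<in>MM. real (card (B m)))"
      by (simp flip: of_nat_sum of_nat_add)
    also have "\<dots> \<le> real (card S) + real (card MM) * (y + 1)"
      using cB by (intro add_left_mono sum_bounded_above)
    also have "real (card S) + real (card MM) * (y + 1)
        \<le> real (card (smooth_set U y)) + real (card (smooth_set U y)) * (y + 1)"
      using cS assms(2) by (intro add_mono mult_right_mono) (auto simp: MM_def intro!: card_mono)
    also have "\<dots> = real (card (smooth_set U y)) * (y + 2)"
      by (simp add: algebra_simps)
    also have "\<dots> \<le> C * U powr \<sigma> * (y + 2)"
      using CU assms(2) by (intro mult_right_mono) auto
    finally show ?thesis by (simp add: U_def algebra_simps)
  qed
qed

subsection \<open>Linear and bilinear exponential sums\<close>

definition dist_int :: "real \<Rightarrow> real" where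
  "dist_int t = \<bar>t - of_int (round t)\<bar>"

lemma dist_int_nonneg: "0 \<le> dist_int t"
  by (simp add: dist_int_def)

lemma dist_int_le_half: "dist_int t \<le> 1 / 2"
  unfolding dist_int_def using of_int_round_abs_le[of t] by (simp add: abs_minus_commute)

lemma norm_add_char [simp]: "norm (add_char t) = 1"
proof -
  have "add_char t = exp (\<i> * of_real (2 * pi * t))" by (simp add: add_char_def algebra_simps)
  then show ?thesis by (simp only: norm_exp_i_times)
qed

lemma add_char_add: "add_char (s + t) = add_char s * add_char t"
  by (simp add: add_char_def algebra_simps flip: exp_add)

lemma add_char_of_int [simp]: "add_char (of_int n) = 1"
proof -
  have "add_char (of_int n) = exp (complex_of_real (2 * of_int n * pi) * \<i>)"
    by (simp add: add_char_def algebra_simps)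
  also have "\<dots> = 1" by (rule exp_integer_2pi) simp
  finally show ?thesis .
qed

lemma add_char_minus: "add_char (- t) = cnj (add_char t)"
  by (simp add: add_char_def exp_cnj)

lemma add_char_mult_nat: "add_char (t * real n) = add_char t ^ n"
  by (induction n) (simp_all add: algebra_simps add_char_add, simp add: add_char_def)

text \<open>With d the signed distance to the nearest integer, the norm is 2 |sin(pi d)|. For s = pi
  |d| <= pi / 2 the cubic Taylor bound and s^2 <= 3 give sin s >= s / 2 >= |d|. The sharp constant
  is 4; the factor lost is harmless.\<close>

lemma norm_add_char_minus_one_ge: "2 * dist_int t \<le> norm (add_char t - 1)"
proof -
  define d where "d = t - of_int (round t)"
  have d: "\<bar>d\<bar> \<le> 1 / 2" using dist_int_le_half[of t] by (simp add: d_def dist_int_def)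
  have "add_char t = add_char d * add_char (of_int (round t))"
    unfolding add_char_add[symmetric] by (simp add: d_def)
  also have "\<dots> = exp (\<i> * of_real (2 * pi * d))"
    unfolding add_char_of_int by (simp add: add_char_def mult_ac)
  finally have eq: "norm (add_char t - 1) = 2 * \<bar>sin (pi * d)\<bar>"
    using dist_exp_i_1[of "2 * pi * d"] by simp
  define s where "s = pi * \<bar>d\<bar>"
  have "\<bar>sin s - (\<Sum>m<3. sin_coeff m * s ^ m)\<bar> \<le> inverse (fact 3) * \<bar>s\<bar> ^ 3"
    by (rule Maclaurin_sin_bound)
  moreover have "(\<Sum>m<3. sin_coeff m * s ^ m) = s"
    by (simp add: eval_nat_numeral sin_coeff_def)
  moreover have s0: "0 \<le> s" by (simp add: s_def)
  ultimately have "\<bar>sin s - s\<bar> \<le> s ^ 3 / 6"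
    by (simp add: fact_numeral)
  then have "s - s ^ 3 / 6 \<le> sin s" by linarith
  moreover have "s ^ 3 / 6 \<le> s / 2"
  proof -
    have "s \<le> pi * (1 / 2)" unfolding s_def using d by (intro mult_left_mono) auto
    also have "\<dots> \<le> 17 / 10" using pi_less_4 pi_approx by simp
    finally have "s ^ 2 \<le> (17 / 10) ^ 2" using s0 by (intro power_mono)
    then have "s ^ 2 \<le> 3" by (simp add: power2_eq_square)
    then have "s * s ^ 2 \<le> s * 3" using s0 by (intro mult_left_mono)
    then show ?thesis by (simp add: eval_nat_numeral)
  qed
  moreover have "2 * \<bar>d\<bar> \<le> s"
    unfolding s_def using pi_ge_two by (intro mult_right_mono) auto
  ultimately have "\<bar>d\<bar> \<le> sin s" by linarith
  moreover have "\<bar>sin (pi * d)\<bar> = \<bar>sin s\<bar>" by (cases "d \<ge> 0") (auto simp: s_def)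
  ultimately show ?thesis unfolding eq by (simp add: d_def dist_int_def)
qed

text \<open>A finite convex set of naturals is an interval, and multiplication by z - 1 telescopes
  the geometric sum. Convexity is the convenient form because the index set in the bilinear estimate
  is cut out by several inequalities.\<close>

lemma norm_sum_add_char_le:
  fixes A :: "nat set"
  assumes "finite A" and convex: "\<And>i j m. i \<in> A \<Longrightarrow> j \<in> A \<Longrightarrow> i \<le> m \<Longrightarrow> m \<le> j \<Longrightarrow> m \<in> A"
    and "dist_int t > 0"
  shows "norm (\<Sum>m\<in>A. add_char (t * real m)) \<le> 1 / dist_int t"
proof (cases "A = {}")
  case False
  define a b where "a = Min A" and "b = Suc (Max A)"
  have "Min A \<in> A" "Max A \<in> A" using assms(1) False by auto
  then have "{a..<b} \<subseteq> A"
    using convex unfolding a_def b_def by (meson atLeastLessThan_iff less_Suc_eq_le subsetI)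
  moreover have "A \<subseteq> {a..<b}"
    unfolding a_def b_def using assms(1) by (auto simp: less_Suc_eq_le)
  ultimately have A: "A = {a..<b}" by blast
  have ab: "a \<le> b" using A False by (cases "a \<le> b") auto
  define z where "z = add_char t"
  have "(\<Sum>m\<in>A. add_char (t * real m)) * (z - 1) = (\<Sum>m=a..<b. z ^ Suc m - z ^ m)"
    unfolding A z_def sum_distrib_right by (simp only: add_char_mult_nat power_Suc2 right_diff_distrib mult_1_right)
  also have "\<dots> = z ^ b - z ^ a" using ab by (rule sum_Suc_diff')
  finally have "norm (\<Sum>m\<in>A. add_char (t * real m)) * norm (z - 1) = norm (z ^ b - z ^ a)"
    by (simp flip: norm_mult)
  also have "\<dots> \<le> norm (z ^ b) + norm (z ^ a)" by (rule norm_triangle_ineq4)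
  also have "\<dots> = 2" by (simp add: norm_power z_def)
  finally have "norm (\<Sum>m\<in>A. add_char (t * real m)) * norm (z - 1) \<le> 2" .
  moreover have "norm (\<Sum>m\<in>A. add_char (t * real m)) * (2 * dist_int t)
      \<le> norm (\<Sum>m\<in>A. add_char (t * real m)) * norm (z - 1)"
    unfolding z_def by (intro mult_left_mono norm_add_char_minus_one_ge) simp
  ultimately show ?thesis using assms(3) by (simp add: field_simps)
qed (use assms in simp)

text \<open>This is \<open>min N (1 / dist_int t)\<close>, except that it is \<open>N\<close> and not \<open>1 / 0 = 0\<close> when \<open>t\<close> is an integer.\<close>
definition trunc_inv :: "real \<Rightarrow> real \<Rightarrow> real" where
  "trunc_inv N t = (if N * dist_int t \<le> 1 then N else 1 / dist_int t)"

text \<open>A single term of the sum suffices: j = 0 if N \<open>dist_int t\<close> <= 1, and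
  otherwise the least j with N \<open>dist_int t\<close> <= 2^j, for which minimality gives 1 /
  \<open>dist_int t\<close> < 2 N / 2^j.\<close>

lemma trunc_inv_le_dyadic:
  assumes "N > 0" and "N \<le> 2 ^ J"
  shows "trunc_inv N t \<le> (\<Sum>j\<le>J. if dist_int t \<le> 2 ^ j / N then 2 * N / 2 ^ j else 0)"
    (is "_ \<le> (\<Sum>j\<le>J. ?f j)")
proof -
  have ge: "?f j \<le> (\<Sum>j\<le>J. ?f j)" if "j \<le> J" for j
    using that assms(1) by (intro member_le_sum) auto
  show ?thesis
  proof (cases "N * dist_int t \<le> 1")
    case True
    then have "dist_int t \<le> 2 ^ 0 / N" using assms(1) by (simp add: field_simps)
    then have "N \<le> ?f 0" using assms(1) by simp
    then show ?thesis using ge[of 0] True by (simp add: trunc_inv_def)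
  next
    case False
    have "dist_int t \<le> 1" using dist_int_le_half[of t] by simp
    then have "N * dist_int t \<le> N * 1" using assms(1) by (intro mult_left_mono) auto
    then have ex: "N * dist_int t \<le> 2 ^ J" using assms(2) by linarith
    define j where "j = (LEAST j. N * dist_int t \<le> 2 ^ j)"
    have j: "N * dist_int t \<le> 2 ^ j" unfolding j_def using ex by (rule LeastI)
    have jJ: "j \<le> J" unfolding j_def using ex by (rule Least_le)
    obtain i where i: "j = Suc i" using j False by (cases j) auto
    have "\<not> N * dist_int t \<le> 2 ^ i"
      using i not_less_Least[of i "\<lambda>j. N * dist_int t \<le> 2 ^ j"] j_def by simp
    then have i2: "2 ^ i < N * dist_int t" by simp
    have d0: "dist_int t > 0" using False assms(1) dist_int_nonneg[of t] by (cases "dist_int t = 0") auto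
    have "1 / dist_int t \<le> 2 * N / 2 ^ j"
      using i2 d0 unfolding i by (simp add: field_simps)
    moreover have "dist_int t \<le> 2 ^ j / N" using j assms(1) by (simp add: field_simps)
    ultimately have "1 / dist_int t \<le> ?f j" by simp
    then show ?thesis using ge[OF jJ] False by (simp add: trunc_inv_def)
  qed
qed

text \<open>Each dyadic scale \<tau> = 2^j / N contributes at most 2 G, because a count linear in
  \<tau> cancels the weight 2 N / 2^j. No scale is below 1 / N, so the count is required only from
  there on.\<close>

lemma sum_trunc_inv_le:
  fixes g :: "nat \<Rightarrow> real"
  assumes "finite B" and "N > 0" and "N \<le> 2 ^ J"
    and count: "\<And>\<tau>. \<tau> \<ge> 1 / N \<Longrightarrow> real (card {l \<in> B. dist_int (g l) \<le> \<tau>}) \<le> \<tau> * G"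
  shows "(\<Sum>l\<in>B. trunc_inv N (g l)) \<le> 2 * real (J + 1) * G"
proof -
  have "(\<Sum>l\<in>B. trunc_inv N (g l))
      \<le> (\<Sum>l\<in>B. \<Sum>j\<le>J. if dist_int (g l) \<le> 2 ^ j / N then 2 * N / 2 ^ j else 0)"
    using assms by (intro sum_mono trunc_inv_le_dyadic)
  also have "\<dots> = (\<Sum>j\<le>J. \<Sum>l\<in>B. if dist_int (g l) \<le> 2 ^ j / N then 2 * N / 2 ^ j else 0)"
    by (rule sum.swap)
  also have "\<dots> = (\<Sum>j\<le>J. (2 * N / 2 ^ j) * real (card {l \<in> B. dist_int (g l) \<le> 2 ^ j / N}))"
    using assms(1) by (intro sum.cong refl) (simp add: sum.inter_filter[symmetric])
  also have "\<dots> \<le> (\<Sum>j\<le>J. (2 * N / 2 ^ j) * (2 ^ j / N * G))"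
    using assms(2) by (intro sum_mono mult_left_mono count divide_right_mono) auto
  also have "\<dots> = (\<Sum>j\<le>J. 2 * G)"
    using assms(2) by (intro sum.cong) auto
  finally show ?thesis by (simp add: algebra_simps)
qed

text \<open>After Cauchy-Schwarz in m, the sum of squares over \<open>A\<close> is extended to all
  integers m in (M, N]. Opening the square leaves, for each pair (k, l), a geometric sum over an
  interval, which the conditions m k <= x and m l <= x only shorten.\<close>

lemma norm_bilinear_sum_le:
  fixes A B :: "nat set" and M N x \<theta> :: real
  assumes "finite A" and "finite B" and "0 \<le> M" and "N \<ge> 0"
    and A: "\<And>m. m \<in> A \<Longrightarrow> M < real m \<and> real m \<le> N"
  shows "(norm (\<Sum>m\<in>A. \<Sum>k | k \<in> B \<and> real (m * k) \<le> x. add_char (\<theta> * real (m * k))))\<^sup>2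
    \<le> real (card A) * (\<Sum>k\<in>B. \<Sum>l\<in>B. trunc_inv N (\<theta> * (real k - real l)))"
proof -
  define W where "W = {m. M < real m \<and> real m \<le> N}"
  have W: "W \<subseteq> {1..nat \<lfloor>N\<rfloor>}" using assms(3) by (auto simp: W_def le_nat_floor)
  then have finW: "finite W" by (rule finite_subset) simp
  define c where "c m k = (if real (m * k) \<le> x then add_char (\<theta> * real (m * k)) else 0)" for m k
  define s where "s m = (\<Sum>k\<in>B. c m k)" for m
  have s: "(\<Sum>k | k \<in> B \<and> real (m * k) \<le> x. add_char (\<theta> * real (m * k))) = s m" for m
    unfolding s_def c_def using assms(2) by (intro sum.inter_filter)
  have inner: "norm (\<Sum>m\<in>W. c m k * cnj (c m l)) \<le> trunc_inv N (\<theta> * (real k - real l))" for k l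
  proof -
    define I where "I = {m \<in> W. real (m * k) \<le> x \<and> real (m * l) \<le> x}"
    let ?t = "\<theta> * (real k - real l)"
    have finI: "finite I" using finW by (simp add: I_def)
    have "(\<Sum>m\<in>W. c m k * cnj (c m l)) = (\<Sum>m\<in>I. add_char (?t * real m))"
    proof -
      have "c m k * cnj (c m l)
          = (if real (m * k) \<le> x \<and> real (m * l) \<le> x then add_char (?t * real m) else 0)" for m
      proof -
        have "add_char (\<theta> * real (m * k)) * cnj (add_char (\<theta> * real (m * l))) = add_char (?t * real m)"
          by (simp add: algebra_simps flip: add_char_minus add_char_add)
        then show ?thesis unfolding c_def by simp
      qed
      then show ?thesis unfolding I_def using sum.inter_filter[OF finW, symmetric] by simp
    qed
    moreover have "norm (\<Sum>m\<in>I. add_char (?t * real m)) \<le> N"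
    proof -
      have "norm (\<Sum>m\<in>I. add_char (?t * real m)) \<le> (\<Sum>m\<in>I. 1)"
        by (rule order_trans[OF norm_sum]) simp
      also have "\<dots> = real (card I)" by simp
      also have "card I \<le> card {1..nat \<lfloor>N\<rfloor>}"
        using W by (intro card_mono) (auto simp: I_def)
      finally show ?thesis using assms(4) by simp linarith
    qed
    moreover have "norm (\<Sum>m\<in>I. add_char (?t * real m)) \<le> 1 / dist_int ?t" if "dist_int ?t > 0"
    proof (rule norm_sum_add_char_le[OF finI _ that])
      fix i j m assume ijm: "i \<in> I" "j \<in> I" "i \<le> m" "m \<le> j"
      have "real m * real k \<le> real j * real k" "real m * real l \<le> real j * real l"
        using ijm by (auto intro!: mult_right_mono)
      then show "m \<in> I" using ijm unfolding I_def W_def by auto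
    qed
    moreover have "dist_int ?t > 0" if "\<not> N * dist_int ?t \<le> 1"
      using that dist_int_nonneg[of ?t] by (cases "dist_int ?t = 0") auto
    ultimately show ?thesis unfolding trunc_inv_def by auto
  qed
  have "(norm (\<Sum>m\<in>A. s m))\<^sup>2 \<le> (\<Sum>m\<in>A. norm (s m))\<^sup>2"
    by (intro power_mono norm_sum) simp
  also have "\<dots> \<le> real (card A) * (\<Sum>m\<in>A. (norm (s m))\<^sup>2)"
    using sum_squared_le_sum_of_squares[of "\<lambda>m. norm (s m)" A] assms(1) by (simp add: mult.commute)
  also have "\<dots> \<le> real (card A) * (\<Sum>m\<in>W. (norm (s m))\<^sup>2)"
    using A finW by (intro mult_left_mono sum_mono2) (auto simp: W_def)
  also have "(\<Sum>m\<in>W. (norm (s m))\<^sup>2) \<le> (\<Sum>k\<in>B. \<Sum>l\<in>B. trunc_inv N (\<theta> * (real k - real l)))"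
  proof -
    have "complex_of_real (\<Sum>m\<in>W. (norm (s m))\<^sup>2) = (\<Sum>m\<in>W. s m * cnj (s m))"
      by (simp add: complex_norm_square del: of_real_power)
    also have "\<dots> = (\<Sum>m\<in>W. \<Sum>k\<in>B. \<Sum>l\<in>B. c m k * cnj (c m l))"
      by (simp add: s_def sum_product)
    also have "\<dots> = (\<Sum>k\<in>B. \<Sum>m\<in>W. \<Sum>l\<in>B. c m k * cnj (c m l))"
      by (rule sum.swap)
    also have "\<dots> = (\<Sum>k\<in>B. \<Sum>l\<in>B. \<Sum>m\<in>W. c m k * cnj (c m l))"
      by (intro sum.cong refl sum.swap)
    finally have eq: "complex_of_real (\<Sum>m\<in>W. (norm (s m))\<^sup>2)
        = (\<Sum>k\<in>B. \<Sum>l\<in>B. \<Sum>m\<in>W. c m k * cnj (c m l))" .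
    have "(\<Sum>m\<in>W. (norm (s m))\<^sup>2) = norm (complex_of_real (\<Sum>m\<in>W. (norm (s m))\<^sup>2))"
      unfolding norm_of_real by (simp add: sum_nonneg)
    also have "\<dots> = norm (\<Sum>k\<in>B. \<Sum>l\<in>B. \<Sum>m\<in>W. c m k * cnj (c m l))"
      unfolding eq ..
    also have "\<dots> \<le> (\<Sum>k\<in>B. \<Sum>l\<in>B. norm (\<Sum>m\<in>W. c m k * cnj (c m l)))"
      by (rule order_trans[OF norm_sum], rule sum_mono, rule norm_sum)
    also have "\<dots> \<le> (\<Sum>k\<in>B. \<Sum>l\<in>B. trunc_inv N (\<theta> * (real k - real l)))"
      by (intro sum_mono inner)
    finally show ?thesis .
  qed
  finally show ?thesis unfolding s by (simp add: mult_left_mono)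
qed

subsection \<open>Pointwise bounds for the exponential sum\<close>

text \<open>Let z be the integer nearest to \<theta> (k - l) and b = (k - l) a - z q. Each value of
  b fixes l modulo q, as a is coprime to q, and |b| <= \<tau> q + 1/2. A nonzero b leaves a
  progression in [0, H]; b = 0 forces |k - l| |\<theta> - a / q| <= \<tau>, hence the shorter range
  |k - l| <= T. Both are counted by \<open>card_smooth_progression_le\<close>.\<close>

lemma card_near_le_raw:
  fixes y C \<sigma> \<theta> H \<tau> T :: real and a :: int and q k :: nat
  assumes bound: "\<And>U. U > 0 \<Longrightarrow> real (card (smooth_set U y)) \<le> C * U powr \<sigma>"
    and "y \<ge> 1" and "q \<ge> 1" and "coprime a (int q)" and "0 \<le> \<tau>" and "0 \<le> T"
    and k: "1 \<le> k" "real k \<le> H"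
    and \<delta>: "H * \<bar>\<theta> - a / q\<bar> \<le> 1 / (2 * q)"
    and T: "\<And>t. 0 \<le> t \<Longrightarrow> t \<le> H \<Longrightarrow> t * \<bar>\<theta> - a / q\<bar> \<le> \<tau> \<Longrightarrow> t \<le> T"
  shows "real (card {l \<in> smooth_set H y. dist_int (\<theta> * (real k - real l)) \<le> \<tau>})
    \<le> (y + 2) * C * (4 * \<tau> * q * (1 + H / q) powr \<sigma> + (1 + 2 * T / q) powr \<sigma>)"
proof -
  define \<delta> where "\<delta> = \<theta> - a / q"
  define L where "L = {l \<in> smooth_set H y. dist_int (\<theta> * (real k - real l)) \<le> \<tau>}"
  have finL: "finite L" by (simp add: L_def)
  define z where "z l = round (\<theta> * (real k - real l))" for l
  define b where "b l = (int k - int l) * a - z l * int q" for l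
  have q0: "real q > 0" using assms(3) by simp
  have b_eq: "real_of_int (b l) / q = (\<theta> * (real k - real l) - z l) - (real k - real l) * \<delta>" for l
    unfolding b_def \<delta>_def using q0 by (simp add: field_simps)
  have Lk: "1 \<le> l" "real l \<le> H" "\<bar>real k - real l\<bar> \<le> H" if "l \<in> L" for l
    using that k by (auto simp: L_def smooth_set_iff abs_le_iff)
  have near: "\<bar>\<theta> * (real k - real l) - z l\<bar> \<le> \<tau>" if "l \<in> L" for l
    using that by (simp add: L_def z_def dist_int_def)
  have b_le: "\<bar>real_of_int (b l)\<bar> \<le> \<tau> * q + 1 / 2" if "l \<in> L" for l
  proof -
    have "\<bar>(real k - real l) * \<delta>\<bar> \<le> H * \<bar>\<delta>\<bar>"
      unfolding abs_mult using Lk[OF that] by (intro mult_right_mono) auto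
    also have "\<dots> \<le> 1 / (2 * q)" using \<delta> by (simp add: \<delta>_def)
    finally have "\<bar>real_of_int (b l) / q\<bar> \<le> \<tau> + 1 / (2 * q)"
      unfolding b_eq using near[OF that] by linarith
    then have "\<bar>real_of_int (b l)\<bar> / q \<le> \<tau> + 1 / (2 * q)" by simp
    then have "\<bar>real_of_int (b l)\<bar> \<le> (\<tau> + 1 / (2 * q)) * q" using q0 by (simp add: pos_divide_le_eq)
    then show ?thesis using q0 by (simp add: algebra_simps)
  qed
  define Lc where "Lc c = {l \<in> L. b l = c}" for c
  have finLc: "finite (Lc c)" for c using finL by (simp add: Lc_def)
  have cong: "int q dvd int l - int l'" if "l \<in> Lc c" "l' \<in> Lc c" for l l' c
  proof -
    have "b l = b l'" using that by (simp add: Lc_def)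
    then have "a * (int l - int l') = int q * (z l' - z l)" unfolding b_def by (simp add: algebra_simps)
    then have "int q dvd a * (int l - int l')" by simp
    then show ?thesis using assms(4) by (simp add: coprime_dvd_mult_right_iff coprime_commute)
  qed
  have smooth: "real p \<le> y" if "l \<in> Lc c" "prime p" "p dvd l" for l c p
    using that by (auto simp: Lc_def L_def smooth_set_iff)
  have H0: "H \<ge> 0" using k by linarith
  define X where "X = (y + 2) * C * (1 + H / q) powr \<sigma>"
  have X: "real (card (Lc c)) \<le> X" for c
    unfolding X_def
    by (rule card_smooth_progression_le[where Z = 0, OF bound assms(2,3) H0 finLc])
      (use Lk smooth cong in \<open>auto simp: Lc_def\<close>)
  have X0: "X \<ge> 0" using X[of 0] by linarith
  have L0: "real (card (Lc 0)) \<le> (y + 2) * C * (1 + 2 * T / q) powr \<sigma>"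
  proof (rule card_smooth_progression_le[where Z = "real k - T", OF bound assms(2,3) _ finLc])
    show "0 \<le> 2 * T" using assms(6) by simp
    fix l assume l: "l \<in> Lc 0"
    then have "l \<in> L" and b0: "b l = 0" by (auto simp: Lc_def)
    have "\<bar>real k - real l\<bar> * \<bar>\<delta>\<bar> \<le> \<tau>"
      using near[OF \<open>l \<in> L\<close>] b_eq[of l] b0 by (simp flip: abs_mult)
    then have "\<bar>real k - real l\<bar> \<le> T"
      using T[of "\<bar>real k - real l\<bar>"] Lk[OF \<open>l \<in> L\<close>] by (simp add: \<delta>_def)
    then show "1 \<le> l \<and> real k - T \<le> real l \<and> real l \<le> real k - T + 2 * T"
      using Lk[OF \<open>l \<in> L\<close>] by (auto simp: abs_le_iff)
  qed (use smooth cong in auto)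
  define \<beta> where "\<beta> = \<lfloor>\<tau> * q + 1 / 2\<rfloor>"
  have cover: "L \<subseteq> Lc 0 \<union> (\<Union>c\<in>{-\<beta>..\<beta>} - {0}. Lc c)"
  proof
    fix l assume l: "l \<in> L"
    have "b l \<le> \<beta>" "- b l \<le> \<beta>"
      unfolding \<beta>_def le_floor_iff using b_le[OF l] by linarith+
    then show "l \<in> Lc 0 \<union> (\<Union>c\<in>{-\<beta>..\<beta>} - {0}. Lc c)" using l by (auto simp: Lc_def)
  qed
  have \<beta>0: "\<beta> \<ge> 0" unfolding \<beta>_def using assms(5) q0 by simp
  \<comment> \<open>There is no additive constant: if \<tau> q < 1/2 then no nonzero value of b
    occurs, and otherwise 2 \<beta> <= 2 \<tau> q + 1 <= 4 \<tau> q.\<close>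
  have card\<beta>: "real (card ({-\<beta>..\<beta>} - {0})) \<le> 4 * \<tau> * q"
  proof -
    have "card ({-\<beta>..\<beta>} - {0}) = nat (2 * \<beta>)" using \<beta>0 by simp
    then have eq: "real (card ({-\<beta>..\<beta>} - {0})) = 2 * real_of_int \<beta>" using \<beta>0 by simp
    have le: "real_of_int \<beta> \<le> \<tau> * q + 1 / 2" unfolding \<beta>_def by simp
    show ?thesis
    proof (cases "\<beta> = 0")
      case True
      then show ?thesis using eq assms(5) by simp
    next
      case False
      then have "real_of_int \<beta> \<ge> 1" using \<beta>0 by simp
      then show ?thesis using eq le by linarith
    qed
  qed
  have "card L \<le> card (Lc 0 \<union> (\<Union>c\<in>{-\<beta>..\<beta>} - {0}. Lc c))"
    using cover finLc by (intro card_mono) auto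
  also have "\<dots> \<le> card (Lc 0) + card (\<Union>c\<in>{-\<beta>..\<beta>} - {0}. Lc c)" by (rule card_Un_le)
  also have "card (\<Union>c\<in>{-\<beta>..\<beta>} - {0}. Lc c) \<le> (\<Sum>c\<in>{-\<beta>..\<beta>} - {0}. card (Lc c))"
    by (rule card_UN_le) simp
  finally have "real (card L) \<le> real (card (Lc 0)) + (\<Sum>c\<in>{-\<beta>..\<beta>} - {0}. real (card (Lc c)))"
    by (simp flip: of_nat_sum of_nat_add)
  also have "\<dots> \<le> real (card (Lc 0)) + real (card ({-\<beta>..\<beta>} - {0})) * X"
    by (intro add_left_mono sum_bounded_above X)
  also have "\<dots> \<le> (y + 2) * C * (1 + 2 * T / q) powr \<sigma> + 4 * \<tau> * q * X"
    by (intro add_mono L0 mult_right_mono card\<beta> X0)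
  finally show ?thesis unfolding X_def L_def by (simp add: algebra_simps)
qed

text \<open>Both terms of \<open>card_near_le_raw\<close> are brought to the form \<tau> times a
  quantity free of \<tau>, as \<open>sum_trunc_inv_le\<close> requires. The bound Q^2 <= 9 x absorbs
  the summand 1 in the two bases.\<close>

lemma card_near_le:
  fixes x y C \<sigma> \<theta> Q \<tau> :: real and a :: int and q k :: nat
  assumes bound: "\<And>U. U > 0 \<Longrightarrow> real (card (smooth_set U y)) \<le> C * U powr \<sigma>"
    and "y \<ge> 1" and "q \<ge> 1" and "coprime a (int q)" and "0 \<le> \<sigma>" and "\<sigma> \<le> 1" and "C \<ge> 1" and "x > 0"
    and Q: "Q = q * (1 + x * \<bar>\<theta> - a / q\<bar>)" "Q \<le> 3 * sqrt x"
    and k: "1 \<le> k" "real k \<le> x / (2 * Q)"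
    and \<tau>: "1 / (2 * Q * y) \<le> \<tau>"
  shows "real (card {l \<in> smooth_set (x / (2 * Q)) y. dist_int (\<theta> * (real k - real l)) \<le> \<tau>})
    \<le> \<tau> * (360 * y ^ 3 * C * x powr \<sigma> * Q powr (1 - 2 * \<sigma>))"
proof -
  define \<delta> where "\<delta> = \<bar>\<theta> - a / q\<bar>"
  define H where "H = x / (2 * Q)"
  \<comment> \<open>Since Q / q = 1 + x \<delta>, the conditions t <= H and t \<delta> <= \<tau> add
    up to t Q / q <= H + x \<tau>.\<close>
  define T where "T = (H + x * \<tau>) * q / Q"
  define w where "w = x * \<tau> / Q"
  define E where "E = Q powr (1 - \<sigma>) * (x / Q) powr \<sigma>"
  have q1: "real q \<ge> 1" using assms(3) by simp
  have d0: "\<delta> \<ge> 0" by (simp add: \<delta>_def)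
  have Qd: "Q = q * (1 + x * \<delta>)" using Q by (simp add: \<delta>_def)
  have "real q * 1 \<le> real q * (1 + x * \<delta>)" using assms(8) d0 q1 by (intro mult_left_mono) auto
  then have qQ: "real q \<le> Q" using Qd by simp
  then have Q1: "Q \<ge> 1" using q1 by linarith
  have QQ: "Q\<^sup>2 \<le> 9 * x"
  proof -
    have "Q\<^sup>2 \<le> (3 * sqrt x)\<^sup>2" using Q Q1 by (intro power_mono) auto
    then show ?thesis using assms(8) by (simp add: power_mult_distrib)
  qed
  have \<tau>0: "\<tau> > 0" using \<tau> Q1 assms(2) by (smt (verit) divide_pos_pos mult_pos_pos)
  have H0: "H > 0" using assms(8) Q1 by (simp add: H_def)
  have raw: "real (card {l \<in> smooth_set H y. dist_int (\<theta> * (real k - real l)) \<le> \<tau>})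
    \<le> (y + 2) * C * (4 * \<tau> * q * (1 + H / q) powr \<sigma> + (1 + 2 * T / q) powr \<sigma>)"
  proof (rule card_near_le_raw[OF bound assms(2,3,4)])
    show "0 \<le> \<tau>" using \<tau>0 by simp
    show "0 \<le> T" unfolding T_def using H0 \<tau>0 assms(8) q1 Q1 by simp
    show "1 \<le> k" "real k \<le> H" using k by (auto simp: H_def)
    have "q * x * \<delta> \<le> Q" using Qd q1 by (simp add: algebra_simps)
    then show "H * \<bar>\<theta> - a / q\<bar> \<le> 1 / (2 * q)"
      unfolding H_def \<delta>_def[symmetric] using q1 Q1 by (simp add: field_simps)
    fix t :: real assume t: "0 \<le> t" "t \<le> H" "t * \<bar>\<theta> - a / q\<bar> \<le> \<tau>"
    have "x * (t * \<delta>) \<le> x * \<tau>" using t assms(8) by (intro mult_left_mono) (auto simp: \<delta>_def)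
    then have "t * (1 + x * \<delta>) \<le> H + x * \<tau>" using t by (simp add: algebra_simps)
    then have "t * (1 + x * \<delta>) * q \<le> (H + x * \<tau>) * q" using q1 by (intro mult_right_mono) auto
    then have "t * Q \<le> (H + x * \<tau>) * q" unfolding Qd by (simp add: algebra_simps)
    then show "t \<le> T" unfolding T_def using Q1 by (simp add: pos_le_divide_eq)
  qed (use bound in auto)
  have p1: "q * (1 + H / q) powr \<sigma> \<le> 19 * E"
  proof -
    have "q * Q \<le> Q * Q" using qQ Q1 by (intro mult_right_mono) auto
    then have "q * Q \<le> 9 * x" using QQ by (simp add: power2_eq_square)
    then have "1 + H / q \<le> 19 * ((x / Q) / q)"
      unfolding H_def using q1 Q1 assms(8) by (simp add: field_simps)
    then have "(1 + H / q) powr \<sigma> \<le> (19 * ((x / Q) / q)) powr \<sigma>"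
      using H0 q1 assms(5) by (intro powr_mono2) auto
    also have "\<dots> = 19 powr \<sigma> * ((x / Q) powr \<sigma> / q powr \<sigma>)"
      using assms(8) Q1 q1 by (simp add: powr_mult powr_divide)
    also have "\<dots> \<le> 19 powr 1 * ((x / Q) powr \<sigma> / q powr \<sigma>)"
      using assms(6) by (intro mult_right_mono powr_mono) auto
    finally have "q * (1 + H / q) powr \<sigma> \<le> q * (19 * ((x / Q) powr \<sigma> / q powr \<sigma>))"
      using q1 by (intro mult_left_mono) auto
    also have "\<dots> = 19 * (q powr (1 - \<sigma>) * (x / Q) powr \<sigma>)"
      using q1 by (simp add: powr_diff)
    also have "\<dots> \<le> 19 * E"
      unfolding E_def using qQ q1 assms(6) by (intro mult_left_mono mult_right_mono powr_mono2) auto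
    finally show ?thesis .
  qed
  \<comment> \<open>The lower bound on \<tau> enters twice. It gives x / (2 Q^2) <= y w, so the base
    is at most (18 + 2 + 2) y w; and once w^\<sigma> is written with a full factor \<tau>, it bounds
    the remaining power of 1 / \<tau> by one of 2 y Q.\<close>
  have p2: "(1 + 2 * T / q) powr \<sigma> \<le> 44 * y\<^sup>2 * \<tau> * E"
  proof -
    have w0: "w > 0" unfolding w_def using assms(8) \<tau>0 Q1 by simp
    have "1 \<le> 2 * Q * y * \<tau>" using \<tau> Q1 assms(2) by (simp add: field_simps)
    then have "x / (2 * Q\<^sup>2) * 1 \<le> x / (2 * Q\<^sup>2) * (2 * Q * y * \<tau>)"
      using assms(8) by (intro mult_left_mono) auto
    also have "\<dots> = y * w" unfolding w_def using Q1 by (simp add: power2_eq_square)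
    finally have yw: "x / (2 * Q\<^sup>2) \<le> y * w" by simp
    have 1: "1 \<le> 18 * (x / (2 * Q\<^sup>2))" using QQ Q1 by (simp add: field_simps)
    have "2 * T / q = 2 * (x / (2 * Q\<^sup>2)) + 2 * w"
      unfolding T_def H_def w_def using q1 Q1 by (simp add: field_simps power2_eq_square)
    also have "w \<le> y * w" using w0 assms(2) by simp
    finally have "1 + 2 * T / q \<le> 22 * (y * w)" using 1 yw by linarith
    moreover have "0 \<le> T / q" unfolding T_def using H0 \<tau>0 assms(8) q1 Q1 by simp
    ultimately have "(1 + 2 * T / q) powr \<sigma> \<le> (22 * y * w) powr \<sigma>"
      using assms(5) by (intro powr_mono2) auto
    also have "\<dots> = (22 * y) powr \<sigma> * w powr \<sigma>"
      using w0 assms(2) by (simp add: powr_mult)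
    also have "\<dots> \<le> (22 * y) powr 1 * w powr \<sigma>"
      using assms(2,6) by (intro mult_right_mono powr_mono) auto
    also have "w powr \<sigma> = \<tau> * ((1 / \<tau>) powr (1 - \<sigma>) * (x / Q) powr \<sigma>)"
      unfolding w_def using \<tau>0 assms(8) Q1
      by (simp add: powr_mult powr_divide powr_diff)
    also have "(1 / \<tau>) powr (1 - \<sigma>) \<le> (2 * y * Q) powr (1 - \<sigma>)"
      using \<tau> \<tau>0 Q1 assms(2,6) by (intro powr_mono2) (auto simp: field_simps)
    also have "\<dots> = (2 * y) powr (1 - \<sigma>) * Q powr (1 - \<sigma>)"
      using assms(2) Q1 by (simp add: powr_mult)
    also have "(2 * y) powr (1 - \<sigma>) \<le> (2 * y) powr 1"
      using assms(2,5) by (intro powr_mono) auto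
    finally show ?thesis
      using assms(2) \<tau>0 unfolding E_def
      by (simp add: mult_left_mono mult_right_mono power2_eq_square mult_ac)
  qed
  have E0: "E \<ge> 0" by (simp add: E_def)
  have E: "E = x powr \<sigma> * Q powr (1 - 2 * \<sigma>)"
  proof -
    have "Q powr (1 - 2 * \<sigma>) = Q powr (1 - \<sigma>) / Q powr \<sigma>" by (simp flip: powr_diff)
    then show ?thesis unfolding E_def using assms(8) Q1 by (simp add: powr_divide)
  qed
  have y2: "1 \<le> y\<^sup>2" using assms(2) by (simp add: one_le_power)
  have "4 * \<tau> * q * (1 + H / q) powr \<sigma> = 4 * \<tau> * (q * (1 + H / q) powr \<sigma>)" by simp
  also have "\<dots> \<le> 4 * \<tau> * (19 * E)" using p1 \<tau>0 by (intro mult_left_mono) auto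
  also have "\<dots> = 76 * (\<tau> * E) * 1" by simp
  also have "\<dots> \<le> 76 * (\<tau> * E) * y\<^sup>2" using y2 \<tau>0 E0 by (intro mult_left_mono) auto
  finally have "4 * \<tau> * q * (1 + H / q) powr \<sigma> + (1 + 2 * T / q) powr \<sigma> \<le> 120 * y\<^sup>2 * \<tau> * E"
    using p2 by (simp add: mult_ac)
  then have "(y + 2) * C * (4 * \<tau> * q * (1 + H / q) powr \<sigma> + (1 + 2 * T / q) powr \<sigma>)
      \<le> (3 * y) * C * (120 * y\<^sup>2 * \<tau> * E)"
    using assms(2,7) \<tau>0 E0 by (intro mult_mono) auto
  also have "\<dots> = \<tau> * (360 * y ^ 3 * C * x powr \<sigma> * Q powr (1 - 2 * \<sigma>))"
    unfolding E by (simp add: power2_eq_square power3_eq_cube)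
  finally show ?thesis using raw unfolding H_def by linarith
qed

lemma card_primes_le:
  assumes "y \<ge> 0"
  shows "real (card {p :: nat. prime p \<and> real p \<le> y}) \<le> y"
proof -
  have "{p :: nat. prime p \<and> real p \<le> y} \<subseteq> smooth_set y y"
  proof
    fix p :: nat assume p: "p \<in> {p. prime p \<and> real p \<le> y}"
    then show "p \<in> smooth_set y y"
      by (auto simp: smooth_set_def prime_prime_factors Suc_le_eq prime_gt_0_nat)
  qed
  then have "card {p :: nat. prime p \<and> real p \<le> y} \<le> smooth_count y y"
    unfolding smooth_count_def by (intro card_mono) auto
  then show ?thesis using smooth_count_le[OF assms, of y] by linarith
qed

text \<open>Numbers up to M are estimated trivially; the others are grouped by the prime that ends
  the head, of which there are at most y.\<close>

lemma norm_smooth_exp_sum_le_small_plus_bilinear: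
  assumes "M \<ge> 1" and "y \<ge> 1" and "b \<ge> 0"
    and small: "real (card (smooth_set M y)) \<le> a"
    and p: "\<And>p. prime p \<Longrightarrow> real p \<le> y \<Longrightarrow>
      norm (\<Sum>m\<in>heads M p. \<Sum>k | k \<in> tails p y \<and> real (m * k) \<le> x. add_char (\<theta> * real (m * k))) \<le> b"
  shows "norm (smooth_exp_sum \<theta> x y) \<le> a + y * b"
proof -
  let ?f = "\<lambda>n. add_char (\<theta> * real n)"
  have "smooth_set x y = {n \<in> smooth_set x y. \<not> M < real n} \<union> {n. n \<in> smooth_set x y \<and> M < real n}"
    by auto
  then have split: "smooth_exp_sum \<theta> x y = (\<Sum>n | n \<in> smooth_set x y \<and> \<not> M < real n. ?f n)
      + (\<Sum>n | n \<in> smooth_set x y \<and> M < real n. ?f n)"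
    unfolding smooth_exp_sum_def by (subst sum.union_disjoint[symmetric]) (auto intro!: sum.cong)
  have "norm (smooth_exp_sum \<theta> x y) \<le> norm (\<Sum>n | n \<in> smooth_set x y \<and> \<not> M < real n. ?f n)
      + norm (\<Sum>n | n \<in> smooth_set x y \<and> M < real n. ?f n)"
    unfolding split by (rule norm_triangle_ineq)
  also have "norm (\<Sum>n | n \<in> smooth_set x y \<and> \<not> M < real n. ?f n) \<le> a"
  proof -
    have "norm (\<Sum>n | n \<in> smooth_set x y \<and> \<not> M < real n. ?f n)
        \<le> (\<Sum>n | n \<in> smooth_set x y \<and> \<not> M < real n. 1)"
      by (rule order_trans[OF norm_sum]) simp
    also have "\<dots> \<le> real (card (smooth_set M y))"
      by (simp, intro card_mono) (auto simp: smooth_set_iff)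
    finally show ?thesis using small by linarith
  qed
  also have "norm (\<Sum>n | n \<in> smooth_set x y \<and> M < real n. ?f n) \<le> y * b"
  proof -
    have "norm (\<Sum>n | n \<in> smooth_set x y \<and> M < real n. ?f n) \<le> (\<Sum>p | prime p \<and> real p \<le> y. b)"
      unfolding sum_smooth_set_head_tail[OF assms(1)]
      by (rule order_trans[OF norm_sum], rule sum_mono, rule p) auto
    also have "\<dots> = real (card {p :: nat. prime p \<and> real p \<le> y}) * b" by simp
    also have "\<dots> \<le> y * b"
      using card_primes_le[of y] assms(2,3) by (intro mult_right_mono) auto
    finally show ?thesis .
  qed
  finally show ?thesis by simp
qed

text \<open>There are at most C N^\<sigma> heads and C H^\<sigma> tails with N H = x y, and for each
  tail k the sum over l is at most 2 (J + 1) G. The square root of the product gives the bilinear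
  part; summing over p costs another factor y.\<close>

lemma norm_smooth_exp_sum_le:
  fixes x y C \<sigma> \<theta> Q :: real and a :: int and q J :: nat
  assumes bound: "\<And>U. U > 0 \<Longrightarrow> real (card (smooth_set U y)) \<le> C * U powr \<sigma>"
    and "y \<ge> 1" and "q \<ge> 1" and "coprime a (int q)" and "0 \<le> \<sigma>" and "\<sigma> \<le> 1" and "C \<ge> 1" and "x > 0"
    and Q: "Q = q * (1 + x * \<bar>\<theta> - a / q\<bar>)" "Q \<le> 3 * sqrt x"
    and J: "2 * Q * y \<le> 2 ^ J"
  shows "norm (smooth_exp_sum \<theta> x y) \<le> 45 * real (J + 1) * C\<^sup>2 * y ^ 3 * x powr \<sigma> * Q powr (1 / 2 - \<sigma>)"
proof -
  \<comment> \<open>A head exceeding 2 Q confines its tail to k <= H = x / (2 Q), the range in which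
    H |\<theta> - a / q| <= 1 / (2 q). \<open>N\<close> bounds the heads for every p <= y.\<close>
  define M where "M = 2 * Q"
  define N where "N = M * y"
  define H where "H = x / (2 * Q)"
  define E where "E = x powr \<sigma> * Q powr (1 - 2 * \<sigma>)"
  define R where "R = x powr \<sigma> * Q powr (1 / 2 - \<sigma>)"
  define V where "V = 27 * real (J + 1) * C\<^sup>2 * y\<^sup>2 * R"
  have q1: "real q \<ge> 1" using assms(3) by simp
  have "real q * 1 \<le> Q" unfolding Q using assms(8) q1 by (intro mult_left_mono) auto
  then have Q1: "Q \<ge> 1" using q1 by linarith
  have M1: "M \<ge> 1" using Q1 by (simp add: M_def)
  have N0: "N > 0" using M1 assms(2) by (simp add: N_def)
  have H0: "H > 0" unfolding H_def using Q1 assms(8) by simp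
  have R0: "R \<ge> 0" and E0: "E \<ge> 0" by (simp_all add: R_def E_def)
  have V0: "V \<ge> 0" unfolding V_def using R0 by simp
  have RR: "R\<^sup>2 = x powr \<sigma> * E"
  proof -
    have "(Q powr (1 / 2 - \<sigma>))\<^sup>2 = Q powr (1 - 2 * \<sigma>)"
      by (simp add: power2_eq_square flip: powr_add)
    then show ?thesis unfolding R_def E_def power_mult_distrib by (simp add: power2_eq_square)
  qed
  have "norm (smooth_exp_sum \<theta> x y) \<le> 18 * C * R + y * V"
  proof (rule norm_smooth_exp_sum_le_small_plus_bilinear[OF M1 assms(2) V0])
    have "real (card (smooth_set M y)) \<le> C * M powr \<sigma>" using bound M1 by simp
    \<comment> \<open>The trivial part fits because Q <= 3 sqrt x: Q^\<sigma> <= (Q^2)^\<sigma>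
      Q^(1/2 - \<sigma>), and Q^2 <= 9 x.\<close>
    also have "M powr \<sigma> \<le> 18 * R"
    proof -
      have "M powr \<sigma> = 2 powr \<sigma> * Q powr \<sigma>" unfolding M_def using Q1 by (simp add: powr_mult)
      also have "\<dots> \<le> 2 powr 1 * Q powr \<sigma>" using assms(6) by (intro mult_right_mono powr_mono) auto
      also have "Q powr \<sigma> = Q powr (2 * \<sigma> - 1 / 2) * Q powr (1 / 2 - \<sigma>)" by (simp flip: powr_add)
      also have "Q powr (2 * \<sigma> - 1 / 2) \<le> Q powr (2 * \<sigma>)" using Q1 by (intro powr_mono) auto
      also have "Q powr (2 * \<sigma>) = (Q\<^sup>2) powr \<sigma>"
        using Q1 by (simp add: powr_powr flip: powr_numeral)
      also have "\<dots> \<le> (9 * x) powr \<sigma>"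
      proof (intro powr_mono2)
        have "Q\<^sup>2 \<le> (3 * sqrt x)\<^sup>2" using Q Q1 by (intro power_mono) auto
        then show "Q\<^sup>2 \<le> 9 * x" using assms(8) by (simp add: power_mult_distrib)
      qed (use assms(5) in auto)
      also have "\<dots> = 9 powr \<sigma> * x powr \<sigma>" using assms(8) by (simp add: powr_mult)
      also have "\<dots> \<le> 9 powr 1 * x powr \<sigma>" using assms(6) by (intro mult_right_mono powr_mono) auto
      finally show ?thesis unfolding R_def by (simp add: mult_right_mono)
    qed
    finally show "real (card (smooth_set M y)) \<le> 18 * C * R" using assms(7) by (simp add: mult_left_mono)
  next
    fix p :: nat assume p: "prime p" "real p \<le> y"
    let ?T = "\<Sum>m\<in>heads M p. \<Sum>k | k \<in> tails p y \<and> real (m * k) \<le> x. add_char (\<theta> * real (m * k))"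
    define B where "B = {k \<in> tails p y. real k \<le> H}"
    have B: "B \<subseteq> smooth_set H y" unfolding B_def by (rule tails_le_subset_smooth_set)
    then have finB: "finite B" by (rule finite_subset) simp
    have MpN: "M * real p \<le> N" unfolding N_def using p M1 by simp
    have heads: "heads M p \<subseteq> smooth_set N y"
    proof
      fix m assume m: "m \<in> heads M p"
      then have "real m \<le> N" using MpN by (auto simp: heads_def)
      moreover have "real r \<le> y" if "prime r" "r dvd m" for r
      proof -
        have "r \<le> p" using m that by (auto simp: heads_def)
        then show ?thesis using p by linarith
      qed
      ultimately show "m \<in> smooth_set N y" using m by (auto simp: smooth_set_iff heads_def)
    qed
    have T: "?T = (\<Sum>m\<in>heads M p. \<Sum>k | k \<in> B \<and> real (m * k) \<le> x. add_char (\<theta> * real (m * k)))"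
    proof (rule sum.cong[OF refl], rule sum.cong[OF _ refl])
      fix m assume m: "m \<in> heads M p"
      have "real k \<le> H" if "real (m * k) \<le> x" for k
      proof -
        have "M * real k \<le> real m * real k" using m by (intro mult_right_mono) (auto simp: heads_def)
        then have "M * real k \<le> x" using that by simp
        then show ?thesis unfolding H_def M_def using Q1 by (simp add: field_simps)
      qed
      then show "{k. k \<in> tails p y \<and> real (m * k) \<le> x} = {k. k \<in> B \<and> real (m * k) \<le> x}"
        by (auto simp: B_def)
    qed
    define G where "G = 360 * y ^ 3 * C * x powr \<sigma> * Q powr (1 - 2 * \<sigma>)"
    have G0: "G \<ge> 0" unfolding G_def using assms(2,7) by simp
    have "(norm ?T)\<^sup>2 \<le> real (card (heads M p)) * (\<Sum>k\<in>B. \<Sum>l\<in>B. trunc_inv N (\<theta> * (real k - real l)))"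
      unfolding T using M1 N0 MpN
      by (intro norm_bilinear_sum_le[OF finite_heads finB, of M]) (auto simp: heads_def)
    also have "\<dots> \<le> real (card (heads M p)) * (real (card B) * (2 * real (J + 1) * G))"
    proof (intro mult_left_mono sum_bounded_above sum_trunc_inv_le)
      show "N \<le> 2 ^ J" using J by (simp add: N_def M_def)
      fix k \<tau> assume k: "k \<in> B" and \<tau>: "1 / N \<le> \<tau>"
      have "real (card {l \<in> B. dist_int (\<theta> * (real k - real l)) \<le> \<tau>})
          \<le> real (card {l \<in> smooth_set H y. dist_int (\<theta> * (real k - real l)) \<le> \<tau>})"
        using B by (intro of_nat_mono card_mono) auto
      also have "\<dots> \<le> \<tau> * G"
        unfolding H_def G_def
      proof (rule card_near_le[OF bound assms(2,3,4,5,6,7,8) Q])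
        show "1 \<le> k" "real k \<le> x / (2 * Q)" using k B by (auto simp: smooth_set_iff H_def)
        show "1 / (2 * Q * y) \<le> \<tau>" using \<tau> by (simp add: N_def M_def)
      qed auto
      finally show "real (card {l \<in> B. dist_int (\<theta> * (real k - real l)) \<le> \<tau>}) \<le> \<tau> * G" .
    qed (use finB N0 in auto)
    also have "\<dots> \<le> (C * N powr \<sigma>) * ((C * H powr \<sigma>) * (2 * real (J + 1) * G))"
    proof (intro mult_mono)
      have "real (card (heads M p)) \<le> real (card (smooth_set N y))"
        using heads by (intro of_nat_mono card_mono) auto
      then show "real (card (heads M p)) \<le> C * N powr \<sigma>" using bound[OF N0] by linarith
      have "real (card B) \<le> real (card (smooth_set H y))"
        using B by (intro of_nat_mono card_mono) auto
      then show "real (card B) \<le> C * H powr \<sigma>" using bound[OF H0] by linarith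
    qed (use G0 assms(7) in auto)
    also have "\<dots> = (N * H) powr \<sigma> * (2 * real (J + 1) * G * C\<^sup>2)"
      using N0 H0 by (simp add: powr_mult power2_eq_square)
    also have "(N * H) powr \<sigma> \<le> y * x powr \<sigma>"
    proof -
      have "N * H = y * x" unfolding N_def M_def H_def using Q1 by simp
      then have "(N * H) powr \<sigma> = y powr \<sigma> * x powr \<sigma>" using assms(2,8) by (simp add: powr_mult)
      also have "y powr \<sigma> \<le> y powr 1" using assms(2,6) by (intro powr_mono) auto
      finally show ?thesis using assms(2) by (simp add: mult_right_mono)
    qed
    also have "y * x powr \<sigma> * (2 * real (J + 1) * G * C\<^sup>2) = 720 * (real (J + 1) * C ^ 3) * (y ^ 4 * R\<^sup>2)"
      unfolding RR E_def G_def by (simp add: eval_nat_numeral mult_ac)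
    \<comment> \<open>The powers are rounded up to a perfect square, 729 = 27^2, so that the root
      can be taken without fractional exponents.\<close>
    also have "\<dots> \<le> 729 * (real (J + 1) ^ 2 * C ^ 4) * (y ^ 4 * R\<^sup>2)"
    proof (rule mult_right_mono)
      have "C ^ 3 \<le> C ^ 4" using assms(7) by (intro power_increasing) auto
      moreover have "real (J + 1) \<le> real (J + 1) ^ 2" by (simp add: power2_eq_square)
      ultimately show "720 * (real (J + 1) * C ^ 3) \<le> 729 * (real (J + 1) ^ 2 * C ^ 4)"
        using assms(7) by (intro mult_mono) auto
    qed simp
    also have "\<dots> = V\<^sup>2" unfolding V_def power_mult_distrib by (simp flip: power_mult)
    finally have "(norm ?T)\<^sup>2 \<le> V\<^sup>2" using G0 assms(7) by (simp add: mult_right_mono)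
    then show "norm ?T \<le> V" using V0 by (rule power2_le_imp_le)
  qed
  also have "18 * C * R + y * V \<le> 45 * real (J + 1) * C\<^sup>2 * y ^ 3 * R"
  proof -
    have "C * R \<le> C\<^sup>2 * R"
      using assms(7) R0 by (intro mult_right_mono) (auto simp: power2_eq_square)
    moreover have "1 \<le> real (J + 1) * y ^ 3"
      using one_le_power[OF assms(2), of 3] mult_mono[of 1 "real (J + 1)" 1 "y ^ 3"] by simp
    ultimately have "C * R * 1 \<le> C\<^sup>2 * R * (real (J + 1) * y ^ 3)"
      using R0 by - (rule mult_mono, auto)
    then show ?thesis unfolding V_def by (simp add: eval_nat_numeral algebra_simps)
  qed
  finally show ?thesis by (simp add: R_def mult.assoc)
qed

subsection \<open>Asymptotics of the smooth counting function\<close>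

lemma log_power_growthD:
  assumes "log_power_growth K y" and "e > 0"
  shows "\<forall>\<^sub>F x in at_top. ln x powr (K - e) \<le> y x \<and> y x \<le> ln x powr (K + e)"
proof -
  obtain \<delta> where \<delta>: "(\<delta> \<longlongrightarrow> 0) at_top" and y: "\<forall>\<^sub>F x in at_top. y x = ln x powr (K + \<delta> x)"
    using assms(1) unfolding log_power_growth_def by blast
  have "\<forall>\<^sub>F x in at_top. \<bar>\<delta> x\<bar> < e"
    using tendstoD[OF \<delta> assms(2)] by (simp add: dist_real_def)
  moreover have "\<forall>\<^sub>F x :: real in at_top. 1 \<le> ln x"
    by real_asymp
  ultimately show ?thesis using y
  proof eventually_elim
    case (elim x)
    then show ?case by (auto intro!: powr_mono simp: abs_less_iff)
  qed
qed

lemma log_power_growth_at_top: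
  assumes "log_power_growth K y" and "K > 0"
  shows "filterlim y at_top at_top"
proof (rule filterlim_at_top_mono)
  show "\<forall>\<^sub>F x in at_top. ln x powr (K - K / 2) \<le> y x"
    using log_power_growthD[OF assms(1), of "K / 2"] assms(2) by (auto elim: eventually_mono)
  have "K - K / 2 > 0" using assms(2) by simp
  then show "filterlim (\<lambda>x. ln x powr (K - K / 2)) at_top at_top" by real_asymp
qed

lemma log_power_growth_le_powr:
  assumes "log_power_growth K y" and "K > 0" and "e > 0"
  shows "\<forall>\<^sub>F x in at_top. y x \<le> x powr e"
proof -
  have "\<forall>\<^sub>F x :: real in at_top. ln x powr (K + 1) \<le> x powr e"
    using assms(2,3) by real_asymp
  with log_power_growthD[OF assms(1) zero_less_one] show ?thesis
    by eventually_elim auto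
qed

section \<open>Rankin's upper bound\<close>

lemma harm_le_one_plus_ln:
  assumes "n \<ge> 1"
  shows "harm n \<le> 1 + ln (real n)"
proof -
  obtain m where m: "n = Suc m" using assms by (cases n) auto
  have "harm (Suc m) - ln (real (Suc m)) \<le> harm (Suc 0) - ln (real (Suc 0))"
    using decseqD[OF decseq_harm_diff_ln, of 0 m] by simp
  then show ?thesis by (simp add: m harm_Suc harm_def)
qed

lemma inverse_one_minus_le_exp:
  fixes t :: real
  assumes "0 \<le> t" and "t \<le> 3 / 4"
  shows "1 / (1 - t) \<le> exp (4 * t)"
proof -
  have "1 / (1 - t) = 1 + t / (1 - t)" using assms by (simp add: field_simps)
  also have "\<dots> \<le> exp (t / (1 - t))" by (rule exp_ge_add_one_self)
  also have "t / (1 - t) \<le> t / (1 / 4)" using assms by (intro divide_left_mono) auto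
  then have "exp (t / (1 - t)) \<le> exp (4 * t)" by simp
  finally show ?thesis .
qed

text \<open>On p <= y one has p^(-\<sigma>) <= y^(1 - \<sigma>) / p, and the sum of 1 / p is bounded
  by the harmonic sum. The assumption \<sigma> >= 1/2 keeps p^(-\<sigma>) <= 3/4, where each Euler
  factor is at most exp(4 p^(-\<sigma>)).\<close>

lemma card_smooth_set_le_rankin:
  fixes y \<sigma> U :: real
  assumes "1 / 2 \<le> \<sigma>" and "\<sigma> \<le> 1" and "y \<ge> 1" and "U > 0"
  shows "real (card (smooth_set U y)) \<le> exp (4 * y powr (1 - \<sigma>) * (1 + ln y)) * U powr \<sigma>"
proof -
  let ?P = "{p :: nat. prime p \<and> real p \<le> y}"
  have eq: "smooth_set U y = {n. 1 \<le> n \<and> real n \<le> U \<and> prime_factors n \<subseteq> ?P}"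
    by (auto simp: smooth_set_def in_prime_factors_iff)
  define n where "n = nat \<lfloor>y\<rfloor>"
  have n: "n \<ge> 1" "real n \<le> y" using assms(3) by (auto simp: n_def le_nat_floor)
  have "(\<Sum>p\<in>?P. real p powr - \<sigma>) \<le> (\<Sum>p\<in>?P. y powr (1 - \<sigma>) * inverse (real p))"
  proof (rule sum_mono)
    fix p assume p: "p \<in> ?P"
    then have p0: "real p > 0" using prime_gt_0_nat by auto
    have "real p powr - \<sigma> = real p powr (1 - \<sigma>) * real p powr - 1"
      unfolding powr_add[symmetric] by simp
    also have "real p powr - 1 = inverse (real p)"
      using p0 by (simp add: powr_minus)
    also have "real p powr (1 - \<sigma>) * inverse (real p) \<le> y powr (1 - \<sigma>) * inverse (real p)"
      using p p0 assms(2) by (intro mult_right_mono powr_mono2) auto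
    finally show "real p powr - \<sigma> \<le> y powr (1 - \<sigma>) * inverse (real p)" .
  qed
  also have "\<dots> = y powr (1 - \<sigma>) * (\<Sum>p\<in>?P. inverse (real p))"
    by (simp add: sum_distrib_left)
  also have "(\<Sum>p\<in>?P. inverse (real p)) \<le> (\<Sum>p\<in>{1..n}. inverse (real p))"
    by (rule sum_mono2) (auto simp: n_def le_nat_floor Suc_le_eq prime_gt_0_nat)
  also have "\<dots> = harm n" by (simp add: harm_def)
  also have "harm n \<le> 1 + ln (real n)" by (rule harm_le_one_plus_ln[OF n(1)])
  also have "ln (real n) \<le> ln y" using n by simp
  finally have sum_le: "(\<Sum>p\<in>?P. real p powr - \<sigma>) \<le> y powr (1 - \<sigma>) * (1 + ln y)"
    by (simp add: mult_left_mono)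
  have t: "0 \<le> real p powr - \<sigma> \<and> real p powr - \<sigma> \<le> 3 / 4" if "p \<in> ?P" for p
  proof -
    have p2: "real p \<ge> 2" using that prime_ge_2_nat by auto
    have "real p powr - \<sigma> \<le> 2 powr - \<sigma>" using p2 assms(1) by (intro powr_mono2') auto
    also have "\<dots> \<le> 2 powr - (1 / 2)" using assms(1) by (intro powr_mono) auto
    also have "\<dots> = 1 / sqrt 2" by (simp add: powr_minus powr_half_sqrt field_simps)
    also have "\<dots> \<le> 3 / 4"
    proof -
      have "4 / 3 \<le> sqrt 2" by (rule real_le_rsqrt) (simp add: power2_eq_square)
      then show ?thesis by (simp add: field_simps)
    qed
    finally show ?thesis by simp
  qed
  have "(\<Prod>p\<in>?P. 1 / (1 - real p powr - \<sigma>)) \<le> (\<Prod>p\<in>?P. exp (4 * real p powr - \<sigma>))"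
  proof (rule prod_mono, rule conjI)
    fix p assume "p \<in> ?P"
    then show "1 / (1 - real p powr - \<sigma>) \<le> exp (4 * real p powr - \<sigma>)"
      using t by (intro inverse_one_minus_le_exp) auto
    show "0 \<le> 1 / (1 - real p powr - \<sigma>)" using t[OF \<open>p \<in> ?P\<close>] by simp
  qed
  also have "\<dots> = exp (4 * (\<Sum>p\<in>?P. real p powr - \<sigma>))"
    using finite_primes_le by (simp add: exp_sum sum_distrib_left)
  also have "\<dots> \<le> exp (4 * y powr (1 - \<sigma>) * (1 + ln y))"
    using sum_le by simp
  finally have prod_le: "(\<Prod>p\<in>?P. 1 / (1 - real p powr - \<sigma>)) \<le> exp (4 * y powr (1 - \<sigma>) * (1 + ln y))" .
  have "real (card (smooth_set U y)) \<le> (\<Prod>p\<in>?P. 1 / (1 - real p powr - \<sigma>)) * U powr \<sigma>"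
    unfolding eq using assms by (intro rankin_prime_set finite_primes_le) auto
  also have "\<dots> \<le> exp (4 * y powr (1 - \<sigma>) * (1 + ln y)) * U powr \<sigma>"
    using prod_le by (intro mult_right_mono) auto
  finally show ?thesis .
qed

text \<open>Rankin's bound with \<sigma> = 1 - 1/K + e: the exponential factor is at most x^e
  because y^(1 - \<sigma>) is bounded by a power of ln x below the first. Uniformity in
  \<open>U\<close> lets one constant serve heads, tails and progressions.\<close>

lemma smooth_count_upper:
  assumes growth: "log_power_growth K y" and "K \<ge> 2" and "0 < e" and "e < 1 / K"
  shows "\<forall>\<^sub>F x in at_top. \<forall>U>0.
    real (card (smooth_set U (y x))) \<le> x powr e * U powr (1 - 1 / K + e)"
proof -
  \<comment> \<open>The exponent of ln x in the bound for y^(1 - \<sigma>), from y <= (ln x)^(K + K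
    e).\<close>
  define s where "s = (K + K * e) * (1 / K - e)"
  have "s = 1 - K * e + e - K * e\<^sup>2"
    unfolding s_def using assms(2) by (simp add: field_simps power2_eq_square)
  moreover have "e < K * e" using assms(2,3) by simp
  moreover have "0 < K * e\<^sup>2" using assms(2,3) by simp
  ultimately have s: "s < 1" by linarith
  have "\<forall>\<^sub>F L :: real in at_top. 4 * L powr s * (1 + (K + K * e) * ln L) \<le> e * L"
    using s assms(3) by real_asymp
  then have asymp: "\<forall>\<^sub>F x :: real in at_top. 4 * ln x powr s * (1 + (K + K * e) * ln (ln x)) \<le> e * ln x"
    using ln_at_top by (rule eventually_compose_filterlim)
  have "K * e > 0" using assms(2,3) by simp
  then have y_le: "\<forall>\<^sub>F x in at_top. ln x powr (K - K * e) \<le> y x \<and> y x \<le> ln x powr (K + K * e)"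
    by (rule log_power_growthD[OF growth])
  have y1: "\<forall>\<^sub>F x in at_top. 1 \<le> y x"
    using log_power_growth_at_top[OF growth] assms(2) by (auto simp: filterlim_at_top)
  have ln1: "\<forall>\<^sub>F x :: real in at_top. 1 \<le> ln x" by real_asymp
  show ?thesis
    using asymp y_le y1 ln1 eventually_gt_at_top[of 0]
  proof eventually_elim
    case (elim x)
    define \<sigma> where "\<sigma> = 1 - 1 / K + e"
    have "1 / K \<le> 1 / 2" using assms(2) by (intro divide_left_mono) auto
    then have \<sigma>: "1 / 2 \<le> \<sigma>" "\<sigma> \<le> 1" unfolding \<sigma>_def using assms by linarith+
    have "y x powr (1 - \<sigma>) \<le> (ln x powr (K + K * e)) powr (1 - \<sigma>)"
      using elim \<sigma> by (intro powr_mono2) auto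
    also have "\<dots> = ln x powr s"
      unfolding s_def \<sigma>_def by (simp add: powr_powr)
    finally have a: "y x powr (1 - \<sigma>) \<le> ln x powr s" .
    have "ln (y x) \<le> ln (ln x powr (K + K * e))"
      using elim by (intro ln_mono) auto
    also have "\<dots> = (K + K * e) * ln (ln x)" using elim by (simp add: ln_powr)
    finally have b: "1 + ln (y x) \<le> 1 + (K + K * e) * ln (ln x)" by simp
    have "4 * y x powr (1 - \<sigma>) * (1 + ln (y x)) \<le> 4 * ln x powr s * (1 + (K + K * e) * ln (ln x))"
      using a b elim by (intro mult_mono) auto
    then have "exp (4 * y x powr (1 - \<sigma>) * (1 + ln (y x))) \<le> exp (e * ln x)"
      using elim by simp
    also have "\<dots> = x powr e" using elim by (simp add: powr_def)
    finally have c: "exp (4 * y x powr (1 - \<sigma>) * (1 + ln (y x))) \<le> x powr e" .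
    show ?case
    proof (intro allI impI)
      fix U :: real assume U: "U > 0"
      have "real (card (smooth_set U (y x))) \<le> exp (4 * y x powr (1 - \<sigma>) * (1 + ln (y x))) * U powr \<sigma>"
        using elim \<sigma> U by (intro card_smooth_set_le_rankin) auto
      also have "\<dots> \<le> x powr e * U powr \<sigma>" using c by (intro mult_right_mono) auto
      finally show "real (card (smooth_set U (y x))) \<le> x powr e * U powr (1 - 1 / K + e)"
        by (simp add: \<sigma>_def)
    qed
  qed
qed

text \<open>Logarithms in \<open>two_power_le_prime_count\<close> give the order y / ln y, which
  exceeds y^(1 - e) eventually.\<close>

lemma prime_count_ge_powr:
  assumes "0 < e"
  shows "\<forall>\<^sub>F y :: real in at_top. y powr (1 - e) \<le> real (card {p :: nat. prime p \<and> real p \<le> y})"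
proof -
  have "\<forall>\<^sub>F y :: real in at_top. y powr (1 - e) \<le> ((y - 1) * ln 2 - ln (y + 1)) / ln y"
    using assms by real_asymp
  then show ?thesis using eventually_ge_at_top[of 2]
  proof eventually_elim
    case (elim y)
    define n where "n = nat \<lfloor>y\<rfloor>"
    have n: "real n \<le> y" "y - 1 \<le> real n" "n \<ge> 2" using elim unfolding n_def by (linarith | simp add: le_nat_floor)+
    have P: "{p. prime p \<and> p \<le> n} = {p :: nat. prime p \<and> real p \<le> y}"
      using n(1) by (auto simp: n_def le_nat_floor)
    define c where "c = card {p :: nat. prime p \<and> real p \<le> y}"
    have "2 ^ n \<le> (n + 1) * n ^ c"
      using two_power_le_prime_count[of n] n unfolding P c_def by simp
    then have "real (2 ^ n) \<le> real ((n + 1) * n ^ c)" by (simp only: of_nat_le_iff)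
    then have "2 ^ n \<le> real (n + 1) * real n ^ c"
      by (simp only: of_nat_mult of_nat_power of_nat_numeral)
    then have "ln (2 ^ n) \<le> ln (real (n + 1) * real n ^ c)" using n by (intro ln_mono) auto
    then have "real n * ln 2 \<le> ln (real (n + 1)) + real c * ln (real n)"
      using n by (simp add: ln_realpow ln_mult)
    moreover have "(y - 1) * ln 2 \<le> real n * ln 2" using n by (intro mult_right_mono) auto
    moreover have "ln (real (n + 1)) \<le> ln (y + 1)" using n by (intro ln_mono) auto
    moreover have "real c * ln (real n) \<le> real c * ln y" using n by (intro mult_left_mono) auto
    ultimately have "(y - 1) * ln 2 - ln (y + 1) \<le> real c * ln y" by linarith
    then have "((y - 1) * ln 2 - ln (y + 1)) / ln y \<le> real c"
      using elim by (simp add: pos_divide_le_eq)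
    then show ?case using elim unfolding c_def by linarith
  qed
qed

text \<open>Products of u = floor(ln x / ln y) distinct primes already suffice. With c primes up to
  y there are at least (c / u)^u of them, c / u >= y^s, and y^u >= x / y.\<close>

lemma smooth_count_lower:
  assumes growth: "log_power_growth K y" and "K \<ge> 2" and "0 < e" and "4 * e < 1 - 1 / K"
  shows "\<forall>\<^sub>F x in at_top. x powr (1 - 1 / K - 4 * e) \<le> real (smooth_count x (y x))"
proof -
  \<comment> \<open>Since u <= y^(1/K + e), y^s u is at most y^(1 - 2 e), below the prime count. The
    fourth e in the statement pays for y^s <= x^e.\<close>
  define s where "s = 1 - 1 / K - 3 * e"
  \<comment> \<open>Chosen so that K - e' = 1 / (1/K + e), which turns the lower growth bound into
    ln x <= y^(1/K + e).\<close>
  define e' where "e' = K - 1 / (1 / K + e)"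
  have ke: "1 / K + e > 0" using assms(2,3) by (simp add: add_pos_pos)
  have "1 / (1 / K + e) < 1 / (1 / K)"
    using assms(2,3) by (intro divide_strict_left_mono) (auto simp: add_pos_pos)
  then have e'0: "e' > 0" by (simp add: e'_def)
  have y_top: "filterlim y at_top at_top" using log_power_growth_at_top[OF growth] assms(2) by simp
  have \<pi>: "\<forall>\<^sub>F x in at_top. y x powr (1 - e) \<le> real (card {p :: nat. prime p \<and> real p \<le> y x})"
    using prime_count_ge_powr[OF assms(3)] y_top by (rule eventually_compose_filterlim)
  have y3: "\<forall>\<^sub>F x in at_top. 3 \<le> y x"
    using y_top by (auto simp: filterlim_at_top)
  have K0: "K > 0" using assms(2) by simp
  have ln1: "\<forall>\<^sub>F x :: real in at_top. 1 \<le> ln x" by real_asymp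
  show ?thesis
    using \<pi> y3 ln1 log_power_growthD[OF growth e'0] log_power_growth_le_powr[OF growth K0 assms(3)]
      log_power_growth_le_powr[OF growth K0 zero_less_one] eventually_gt_at_top[of 1]
  proof eventually_elim
    case (elim x)
    define c where "c = card {p :: nat. prime p \<and> real p \<le> y x}"
    define u where "u = nat \<lfloor>ln x / ln (y x)\<rfloor>"
    have "1 / K > 0" using K0 by simp
    then have s: "0 < s" "s \<le> 1" unfolding s_def using assms by linarith+
    have ly: "ln (y x) \<ge> 1" using elim ln3_gt_1 ln_mono[of 3 "y x"] by linarith
    have "ln (y x) \<le> ln x" using elim by (intro ln_mono) auto
    then have u1: "u \<ge> 1" unfolding u_def using ly by (simp add: le_nat_floor)
    have uq: "real u \<le> ln x / ln (y x)" "ln x / ln (y x) - 1 \<le> real u"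
    proof -
      have "0 \<le> ln x / ln (y x)" using ly elim by simp
      then show "real u \<le> ln x / ln (y x)" "ln x / ln (y x) - 1 \<le> real u"
        unfolding u_def by linarith+
    qed
    have "ln x / ln (y x) \<le> ln x / 1" using ly elim by (intro divide_left_mono) auto
    then have "real u \<le> ln x" using uq by simp
    also have "\<dots> = (ln x powr (1 / (1 / K + e))) powr (1 / K + e)"
      using elim ke by (simp add: powr_powr)
    also have "\<dots> \<le> y x powr (1 / K + e)"
      using elim ke by (intro powr_mono2) (auto simp: e'_def)
    finally have u_le: "real u \<le> y x powr (1 / K + e)" .
    have "y x powr s * real u \<le> y x powr s * y x powr (1 / K + e)"
      using u_le by (intro mult_left_mono) auto
    also have "\<dots> = y x powr (1 - 2 * e)" by (simp add: s_def flip: powr_add)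
    also have "\<dots> \<le> y x powr (1 - e)" using elim assms(3) by (intro powr_mono) auto
    also have "\<dots> \<le> real c" using elim by (simp add: c_def)
    finally have cu: "y x powr s * real u \<le> real c" .
    have "1 \<le> y x powr s" using elim s by (intro ge_one_powr_ge_zero) auto
    then have "1 * real u \<le> y x powr s * real u" by (intro mult_right_mono) auto
    then have "u \<le> c" using cu by simp
    have "x powr (1 - 1 / K - 4 * e) = x powr s * x powr (- e)"
      by (simp add: s_def flip: powr_add)
    also have "\<dots> \<le> x powr s * y x powr (- s)"
    proof (intro mult_left_mono)
      have "y x powr s \<le> y x powr 1" using elim s by (intro powr_mono) auto
      then have "y x powr s \<le> x powr e" using elim by simp
      then show "x powr - e \<le> y x powr - s" using elim
        by (simp add: powr_minus le_imp_inverse_le)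
    qed simp
    also have "\<dots> = exp (s * (ln x - ln (y x)))"
      using elim by (simp add: powr_def algebra_simps flip: exp_add)
    also have "\<dots> \<le> exp (s * (real u * ln (y x)))"
    proof -
      have "(ln x / ln (y x) - 1) * ln (y x) \<le> real u * ln (y x)"
        using uq ly by (intro mult_right_mono) auto
      then have "ln x - ln (y x) \<le> real u * ln (y x)"
        using ly by (simp add: left_diff_distrib)
      then show ?thesis using s by simp
    qed
    also have "\<dots> = (y x powr s) ^ u"
      using elim by (simp add: powr_def exp_of_nat_mult[symmetric] mult_ac)
    also have "\<dots> \<le> (real c / real u) ^ u"
      using cu u1 by (intro power_mono) (auto simp: field_simps)
    also have "\<dots> \<le> real (c choose u)"
      using \<open>u \<le> c\<close> by (rule binomial_ge_n_over_k_pow_k)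
    also have "\<dots> \<le> real (smooth_count x (y x))"
    proof -
      have "y x ^ u = exp (real u * ln (y x))"
        using elim by (simp add: exp_of_nat_mult)
      also have "\<dots> \<le> exp (ln x)"
        using uq ly by (simp add: field_simps)
      finally have "y x ^ u \<le> x" using elim by simp
      then show ?thesis
        using smooth_count_ge_binomial[of "y x" u x] elim by (simp add: c_def)
    qed
    finally show ?case .
  qed
qed

subsection \<open>Mean values\<close>

lemma add_char_has_integral:
  "((\<lambda>\<theta>. add_char (\<theta> * of_int h)) has_integral (if h = 0 then 1 else 0)) {0..1}"
proof (cases "h = 0")
  case True
  have "((\<lambda>\<theta>::real. 1 :: complex) has_integral 1) {0..1}"
    using has_integral_const_real[of "1 :: complex" 0 1] by simp
  moreover have "add_char 0 = 1" by (simp add: add_char_def)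
  ultimately show ?thesis using True by simp
next
  case False
  define c where "c = 2 * complex_of_real pi * \<i> * of_int h"
  have c0: "c \<noteq> 0" using False by (simp add: c_def)
  have eq: "add_char (\<theta> * of_int h) = exp (c * of_real \<theta>)" for \<theta>
    by (simp add: add_char_def c_def mult_ac)
  have "((\<lambda>\<theta>. exp (c * of_real \<theta>)) has_integral (exp (c * of_real 1) / c - exp (c * of_real 0) / c)) {0..1}"
  proof (rule fundamental_theorem_of_calculus)
    fix \<theta> :: real
    have "((\<lambda>z. exp (c * z) / c) has_field_derivative exp (c * of_real \<theta>)) (at (of_real \<theta>))"
      using c0 by (auto intro!: derivative_eq_intros)
    then have "((\<lambda>\<theta>. exp (c * of_real \<theta>) / c) has_vector_derivative exp (c * of_real \<theta>)) (at \<theta>)"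
      by (rule has_vector_derivative_real_field)
    then show "((\<lambda>\<theta>. exp (c * of_real \<theta>) / c) has_vector_derivative exp (c * of_real \<theta>)) (at \<theta> within {0..1})"
      by (rule has_vector_derivative_at_within)
  qed simp
  moreover have "exp (c * of_real 1) = 1"
    using eq[of 1] by simp
  ultimately show ?thesis using False eq by simp
qed

lemma smooth_exp_sum_parseval:
  "((\<lambda>\<theta>. (norm (smooth_exp_sum \<theta> x y))\<^sup>2) has_integral real (smooth_count x y)) {0..1}"
proof -
  let ?S = "smooth_set x y"
  have eq: "complex_of_real ((norm (smooth_exp_sum \<theta> x y))\<^sup>2)
      = (\<Sum>n\<in>?S. \<Sum>m\<in>?S. add_char (\<theta> * of_int (int n - int m)))" for \<theta>
  proof -
    have "complex_of_real ((norm (smooth_exp_sum \<theta> x y))\<^sup>2)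
        = smooth_exp_sum \<theta> x y * cnj (smooth_exp_sum \<theta> x y)"
      by (simp add: complex_norm_square del: of_real_power)
    also have "\<dots> = (\<Sum>n\<in>?S. \<Sum>m\<in>?S. add_char (\<theta> * real n) * cnj (add_char (\<theta> * real m)))"
      by (simp add: smooth_exp_sum_def sum_product)
    also have "\<dots> = (\<Sum>n\<in>?S. \<Sum>m\<in>?S. add_char (\<theta> * of_int (int n - int m)))"
      by (intro sum.cong refl) (simp add: algebra_simps flip: add_char_minus add_char_add)
    finally show ?thesis .
  qed
  have "((\<lambda>\<theta>. \<Sum>n\<in>?S. \<Sum>m\<in>?S. add_char (\<theta> * of_int (int n - int m))) has_integral
      (\<Sum>n\<in>?S. \<Sum>m\<in>?S. if int n - int m = 0 then 1 else 0)) {0..1}"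
    by (intro has_integral_sum finite_smooth_set add_char_has_integral)
  also have "(\<Sum>n\<in>?S. \<Sum>m\<in>?S. if int n - int m = 0 then 1 else 0) = (of_nat (smooth_count x y) :: complex)"
    by (simp add: smooth_count_def)
  finally have "((\<lambda>\<theta>. complex_of_real ((norm (smooth_exp_sum \<theta> x y))\<^sup>2)) has_integral
      of_nat (smooth_count x y)) {0..1}"
    unfolding eq .
  from has_integral_linear[OF this bounded_linear_Re] show ?thesis by (simp add: o_def)
qed

lemma continuous_on_norm_smooth_exp_sum:
  "continuous_on A (\<lambda>\<theta>. norm (smooth_exp_sum \<theta> x y))"
  unfolding smooth_exp_sum_def add_char_def by (intro continuous_intros)

section \<open>Arcs around rationals and their measure\<close>

lemma integral_interval_indicator_le:
  fixes c w :: real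
  assumes "w \<ge> 0"
  shows "(\<lambda>\<theta>. if \<bar>\<theta> - c\<bar> \<le> w then 1 else 0 :: real) integrable_on {0..1}"
    and "integral {0..1} (\<lambda>\<theta>. if \<bar>\<theta> - c\<bar> \<le> w then 1 else 0 :: real) \<le> 2 * w"
proof -
  have eq: "(\<lambda>\<theta>. if \<bar>\<theta> - c\<bar> \<le> w then 1 else 0 :: real) = (\<lambda>\<theta>. if \<theta> \<in> {c - w..c + w} then 1 else 0)"
    by (auto simp: fun_eq_iff abs_le_iff)
  have Int: "{c - w..c + w} \<inter> {0..1} = {max (c - w) 0..min (c + w) 1}" by auto
  show "(\<lambda>\<theta>. if \<bar>\<theta> - c\<bar> \<le> w then 1 else 0 :: real) integrable_on {0..1}"
    unfolding eq integrable_restrict_Int Int by (rule integrable_const_ivl)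
  have "integral {0..1} (\<lambda>\<theta>. if \<bar>\<theta> - c\<bar> \<le> w then 1 else 0 :: real)
      = integral {max (c - w) 0..min (c + w) 1} (\<lambda>_. 1)"
    unfolding eq integral_restrict_Int Int_commute[of "{0..1}"] Int ..
  also have "\<dots> \<le> 2 * w" using assms by (auto simp: max_def min_def)
  finally show "integral {0..1} (\<lambda>\<theta>. if \<bar>\<theta> - c\<bar> \<le> w then 1 else 0 :: real) \<le> 2 * w" .
qed

text \<open>A majorant for the indicator of the \<theta> with Q <= Z, since Q <= Z gives q <= Z and
  |\<theta> - a / q| <= Z / (q x). Overlapping arcs and unreduced fractions only enlarge it, and as
  a sum of indicators it is integrated term by term.\<close>

definition arc_count :: "real \<Rightarrow> real \<Rightarrow> real \<Rightarrow> real" where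
  "arc_count x Z \<theta> = (\<Sum>q\<in>{1..nat \<lfloor>Z\<rfloor>}. \<Sum>a\<in>{0..int q}.
     if \<bar>\<theta> - of_int a / real q\<bar> \<le> Z / (real q * x) then 1 else 0)"

lemma arc_count_nonneg: "0 \<le> arc_count x Z \<theta>"
  unfolding arc_count_def by (intro sum_nonneg) auto

lemma arc_count_ge_one:
  assumes "1 \<le> q" and "real q \<le> Z" and "0 \<le> a" and "a \<le> int q"
    and "\<bar>\<theta> - of_int a / real q\<bar> \<le> Z / (real q * x)"
  shows "1 \<le> arc_count x Z \<theta>"
proof -
  let ?f = "\<lambda>q a. if \<bar>\<theta> - of_int a / real q\<bar> \<le> Z / (real q * x) then 1 else 0 :: real"
  have "1 \<le> ?f q a" using assms by simp
  also have "\<dots> \<le> (\<Sum>a\<in>{0..int q}. ?f q a)"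
    using assms by (intro member_le_sum[of a _ "?f q"]) auto
  also have "\<dots> \<le> arc_count x Z \<theta>"
    unfolding arc_count_def using assms
    by (intro member_le_sum[of q _ "\<lambda>q. \<Sum>a\<in>{0..int q}. ?f q a"]) (auto simp: le_nat_floor intro!: sum_nonneg)
  finally show ?thesis .
qed

text \<open>Each q has q + 1 <= 2 q numerators with arcs of length at most 2 Z / (q x), so it
  contributes at most 4 Z / x, and at most Z values of q occur.\<close>

lemma arc_count_integral:
  assumes "x > 0" and "Z \<ge> 0"
  shows "arc_count x Z integrable_on {0..1}" and "integral {0..1} (arc_count x Z) \<le> 4 * Z\<^sup>2 / x"
proof -
  let ?f = "\<lambda>q a \<theta>. if \<bar>\<theta> - of_int a / real q\<bar> \<le> Z / (real q * x) then 1 else 0 :: real"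
  have arc: "arc_count x Z = (\<lambda>\<theta>. \<Sum>q\<in>{1..nat \<lfloor>Z\<rfloor>}. \<Sum>a\<in>{0..int q}. ?f q a \<theta>)"
    by (simp add: arc_count_def fun_eq_iff)
  have w: "Z / (real q * x) \<ge> 0" for q using assms by simp
  note int = integral_interval_indicator_le[OF w]
  show "arc_count x Z integrable_on {0..1}"
    unfolding arc by (intro integrable_sum int) auto
  have "integral {0..1} (arc_count x Z)
      = (\<Sum>q\<in>{1..nat \<lfloor>Z\<rfloor>}. \<Sum>a\<in>{0..int q}. integral {0..1} (?f q a))"
    unfolding arc by (subst integral_sum, (intro integrable_sum int | simp)+, intro sum.cong refl,
      subst integral_sum, (intro int | simp)+)
  also have "\<dots> \<le> (\<Sum>q\<in>{1..nat \<lfloor>Z\<rfloor>}. \<Sum>a\<in>{0..int q}. 2 * (Z / (real q * x)))"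
    by (intro sum_mono int)
  also have "\<dots> \<le> (\<Sum>q\<in>{1..nat \<lfloor>Z\<rfloor>}. 4 * Z / x)"
  proof (rule sum_mono)
    fix q assume q: "q \<in> {1..nat \<lfloor>Z\<rfloor>}"
    have "(\<Sum>a\<in>{0..int q}. 2 * (Z / (real q * x))) = real (q + 1) * (2 * (Z / (real q * x)))" by simp
    also have "\<dots> \<le> (2 * real q) * (2 * (Z / (real q * x)))"
      using q assms by (intro mult_right_mono) auto
    also have "\<dots> = 4 * Z / x" using q assms by simp
    finally show "(\<Sum>a\<in>{0..int q}. 2 * (Z / (real q * x))) \<le> 4 * Z / x" .
  qed
  also have "\<dots> = real (nat \<lfloor>Z\<rfloor>) * (4 * Z / x)" by simp
  also have "\<dots> \<le> Z * (4 * Z / x)"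
    using assms by (intro mult_right_mono) auto
  finally show "integral {0..1} (arc_count x Z) \<le> 4 * Z\<^sup>2 / x" by (simp add: power2_eq_square mult_ac)
qed

text \<open>Where |S| <= b, the integrand is at most b^(\<rho> - 2) |S|^2 and Parseval applies.
  Elsewhere it is at most \<open>c j powr \<rho>\<close> times the arc count of some layer
  j.\<close>

lemma smooth_moment_le_layers:
  fixes \<rho> x y b :: real and c Z :: "nat \<Rightarrow> real" and J :: nat
  assumes "\<rho> > 2" and "x > 0" and "\<And>j. 0 \<le> Z j"
    and cover: "\<And>\<theta>. 0 \<le> \<theta> \<Longrightarrow> \<theta> \<le> 1 \<Longrightarrow> norm (smooth_exp_sum \<theta> x y) \<le> b \<or>
      (\<exists>j\<le>J. norm (smooth_exp_sum \<theta> x y) \<le> c j \<and> 1 \<le> arc_count x (Z j) \<theta>)"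
  shows "smooth_moment \<rho> x y \<le> b powr (\<rho> - 2) * real (smooth_count x y)
    + (\<Sum>j\<le>J. c j powr \<rho> * (4 * (Z j)\<^sup>2 / x))"
proof -
  define f where "f \<theta> = norm (smooth_exp_sum \<theta> x y)" for \<theta>
  define g where "g \<theta> = b powr (\<rho> - 2) * (f \<theta>)\<^sup>2 + (\<Sum>j\<le>J. c j powr \<rho> * arc_count x (Z j) \<theta>)" for \<theta>
  have f0: "0 \<le> f \<theta>" for \<theta> by (simp add: f_def)
  have "continuous_on {0..1} (\<lambda>\<theta>. f \<theta> powr \<rho>)"
    unfolding f_def using assms(1) continuous_on_norm_smooth_exp_sum
    by (intro continuous_on_powr' continuous_on_const) auto
  then have int_f: "(\<lambda>\<theta>. f \<theta> powr \<rho>) integrable_on {0..1}"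
    by (rule integrable_continuous_real)
  have pars: "((\<lambda>\<theta>. (f \<theta>)\<^sup>2) has_integral real (smooth_count x y)) {0..1}"
    unfolding f_def by (rule smooth_exp_sum_parseval)
  have int_arc: "arc_count x (Z j) integrable_on {0..1}" for j
    using arc_count_integral(1)[OF assms(2,3)] .
  have has_g: "(g has_integral (b powr (\<rho> - 2) * real (smooth_count x y)
      + (\<Sum>j\<le>J. c j powr \<rho> * integral {0..1} (arc_count x (Z j))))) {0..1}"
    unfolding g_def
    by (intro has_integral_add has_integral_mult_right pars has_integral_sum integrable_integral int_arc) auto
  have le: "f \<theta> powr \<rho> \<le> g \<theta>" if \<theta>: "\<theta> \<in> {0..1}" for \<theta>
  proof -
    have s0: "0 \<le> c j powr \<rho> * arc_count x (Z j) \<theta>" for j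
      using arc_count_nonneg by simp
    consider "f \<theta> \<le> b" | j where "j \<le> J" "f \<theta> \<le> c j" "1 \<le> arc_count x (Z j) \<theta>"
      using cover[of \<theta>] \<theta> unfolding f_def by auto
    then show ?thesis
    proof cases
      case 1
      have "f \<theta> powr \<rho> = f \<theta> powr (\<rho> - 2) * (f \<theta>)\<^sup>2"
      proof (cases "f \<theta> = 0")
        case False
        then have "f \<theta> > 0" using f0[of \<theta>] by simp
        then have "(f \<theta>)\<^sup>2 = f \<theta> powr 2" by simp
        then show ?thesis by (simp flip: powr_add)
      qed simp
      also have "\<dots> \<le> b powr (\<rho> - 2) * (f \<theta>)\<^sup>2"
        using 1 f0 assms(1) by (intro mult_right_mono powr_mono2) auto
      also have "\<dots> \<le> g \<theta>" unfolding g_def using s0 by (simp add: sum_nonneg)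
      finally show ?thesis .
    next
      case 2
      have "f \<theta> powr \<rho> * 1 \<le> c j powr \<rho> * arc_count x (Z j) \<theta>"
        using 2 f0 assms(1) by (intro mult_mono powr_mono2) auto
      also have "\<dots> \<le> (\<Sum>j\<le>J. c j powr \<rho> * arc_count x (Z j) \<theta>)"
        using 2 s0 by (intro member_le_sum[of j _ "\<lambda>j. c j powr \<rho> * arc_count x (Z j) \<theta>"]) auto
      also have "\<dots> \<le> g \<theta>" unfolding g_def by simp
      finally show ?thesis by simp
    qed
  qed
  have "smooth_moment \<rho> x y = integral {0..1} (\<lambda>\<theta>. f \<theta> powr \<rho>)"
    by (simp add: smooth_moment_def f_def)
  also have "\<dots> \<le> integral {0..1} g"
    using int_f has_g le by (intro integral_le) auto
  also have "\<dots> = b powr (\<rho> - 2) * real (smooth_count x y)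
      + (\<Sum>j\<le>J. c j powr \<rho> * integral {0..1} (arc_count x (Z j)))"
    using has_g by (rule integral_unique)
  also have "\<dots> \<le> b powr (\<rho> - 2) * real (smooth_count x y)
      + (\<Sum>j\<le>J. c j powr \<rho> * (4 * (Z j)\<^sup>2 / x))"
    using assms by (intro add_left_mono sum_mono mult_left_mono arc_count_integral(2)) auto
  finally show ?thesis .
qed

text \<open>Dirichlet's theorem with N just above sqrt x gives q <= sqrt x + 1 and x q |\<theta> - a
  / q| <= sqrt x.\<close>

lemma ex_rational_approx:
  fixes x \<theta> :: real
  assumes "x \<ge> 1" and "0 \<le> \<theta>" and "\<theta> \<le> 1"
  obtains a :: int and q :: nat where "1 \<le> q" "coprime a (int q)" "0 \<le> a" "a \<le> int q"
    "q * (1 + x * \<bar>\<theta> - a / q\<bar>) \<le> 3 * sqrt x"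
proof -
  define N where "N = nat \<lfloor>sqrt x\<rfloor> + 1"
  have s1: "sqrt x \<ge> 1" using assms by simp
  have N: "N > 0" "sqrt x \<le> real N" "real N \<le> sqrt x + 1"
    unfolding N_def using s1 by (simp, linarith+)
  obtain h k where hk: "coprime h k" "0 < k" "k \<le> int N" "\<bar>of_int k * \<theta> - of_int h\<bar> < 1 / N"
    using Dirichlet_approx_coprime[OF N(1)] by metis
  define q where "q = nat k"
  have k: "k = int q" using hk by (simp add: q_def)
  have q1: "1 \<le> q" using hk by (simp add: q_def)
  have near: "\<bar>q * \<theta> - h\<bar> < 1 / N" using hk(4) k by simp
  have N1: "1 / real N \<le> 1" using N by simp
  have "0 \<le> q * \<theta>" "q * \<theta> \<le> q * 1" using assms q1 by (auto intro!: mult_left_mono)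
  \<comment> \<open>The strict bound |q \<theta> - h| < 1 / N <= 1 gives -1 < h < q + 1, and h is an
    integer.\<close>
  then have h: "0 \<le> h" "h \<le> int q" using near N1 by linarith+
  have qd: "q * \<bar>\<theta> - h / q\<bar> = \<bar>q * \<theta> - h\<bar>"
  proof -
    have "q * \<bar>\<theta> - h / q\<bar> = \<bar>q * (\<theta> - h / q)\<bar>" by (simp add: abs_mult)
    also have "q * (\<theta> - h / q) = q * \<theta> - h" using q1 by (simp add: field_simps)
    finally show ?thesis .
  qed
  have "q * (1 + x * \<bar>\<theta> - h / q\<bar>) = q + x * (q * \<bar>\<theta> - h / q\<bar>)" by (simp add: algebra_simps)
  also have "\<dots> \<le> (sqrt x + 1) + x * (1 / sqrt x)"
  proof (intro add_mono mult_left_mono)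
    show "real q \<le> sqrt x + 1" using hk(3) N(3) k by linarith
    have "1 / real N \<le> 1 / sqrt x" using N s1 by (intro divide_left_mono mult_pos_pos) linarith+
    then show "q * \<bar>\<theta> - h / q\<bar> \<le> 1 / sqrt x" unfolding qd using near by linarith
  qed (use assms in simp)
  also have "x * (1 / sqrt x) = sqrt x" using assms by (simp add: real_div_sqrt)
  finally have "q * (1 + x * \<bar>\<theta> - h / q\<bar>) \<le> 3 * sqrt x" using s1 by linarith
  then show thesis using that[of q h] q1 hk(1) k h by simp
qed

text \<open>One approximation a / q serves two applications of
  \<open>norm_smooth_exp_sum_le\<close>: C = 1, \<sigma> = 1, and C = x^e, \<sigma> = 1 - 1/K + e.
  In the second, the loss 4 e consists of e for y^3 and the logarithm, 2 e for C^2, and e from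
  \<sigma>.\<close>

lemma smooth_exp_sum_bounds:
  assumes growth: "log_power_growth K y" and "K \<ge> 3" and "0 < e" and "e < 1 / K"
  shows "\<forall>\<^sub>F x in at_top. \<forall>\<theta>. 0 \<le> \<theta> \<longrightarrow> \<theta> \<le> 1 \<longrightarrow> (\<exists>(a :: int) (q :: nat) Q.
    1 \<le> q \<and> 0 \<le> a \<and> a \<le> int q \<and> Q = q * (1 + x * \<bar>\<theta> - a / q\<bar>) \<and>
    norm (smooth_exp_sum \<theta> x (y x)) \<le> x powr (1 + e) * Q powr - (1 / 2) \<and>
    norm (smooth_exp_sum \<theta> x (y x)) \<le> x powr (1 - 1 / K + 4 * e) * Q powr - ((1 - 3 * (1 / K)) / 2))"
proof -
  have K0: "K > 0" using assms(2) by simp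
  have y1: "\<forall>\<^sub>F x in at_top. 1 \<le> y x"
    using log_power_growth_at_top[OF growth K0] by (auto simp: filterlim_at_top)
  have e6: "e / 6 > 0" using assms(3) by simp
  have asymp: "\<forall>\<^sub>F x :: real in at_top. 45 * (2 * log 2 x + 2) * x powr (e / 2) \<le> x powr e"
    using assms(3) by real_asymp
  have asymp2: "\<forall>\<^sub>F x :: real in at_top. 6 * sqrt x * x powr (e / 6) \<le> x powr 2"
  proof -
    have "1 / K \<le> 1 / 3" using assms(2) by (intro divide_left_mono) auto
    then have "e < 1 / 3" using assms(4) by linarith
    then show ?thesis using assms(3) by real_asymp
  qed
  have K2: "K \<ge> 2" using assms(2) by simp
  show ?thesis
    using asymp asymp2 y1 log_power_growth_le_powr[OF growth K0 e6]
      smooth_count_upper[OF growth K2 assms(3,4)] eventually_ge_at_top[of 1]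
  proof eventually_elim
    case (elim x)
    \<comment> \<open>This makes 2^J at least x^2, hence at least 2 Q y, while J + 1 stays
      logarithmic in x.\<close>
    define J where "J = nat \<lceil>2 * log 2 x\<rceil>"
    define \<sigma> where "\<sigma> = 1 - 1 / K + e"
    have "log 2 x \<ge> 0" using elim by simp
    then have J: "2 * log 2 x \<le> real J" "real J \<le> 2 * log 2 x + 1" unfolding J_def by linarith+
    have "1 / K \<le> 1 / 3" using assms(2) by (intro divide_left_mono) auto
    moreover have "1 / K > 0" using K0 by simp
    ultimately have \<sigma>: "0 \<le> \<sigma>" "\<sigma> \<le> 1" unfolding \<sigma>_def using assms(3,4) by linarith+
    have "y x ^ 3 \<le> (x powr (e / 6)) ^ 3" using elim by (intro power_mono) auto
    also have "\<dots> = x powr (e / 2)" by (simp add: power3_eq_cube flip: powr_add)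
    finally have "45 * real (J + 1) * y x ^ 3 \<le> 45 * (2 * log 2 x + 2) * x powr (e / 2)"
      using J elim by (intro mult_mono) auto
    then have const: "45 * real (J + 1) * y x ^ 3 \<le> x powr e" using elim by linarith
    show ?case
    proof (intro allI impI)
      fix \<theta> :: real assume \<theta>: "0 \<le> \<theta>" "\<theta> \<le> 1"
      obtain a :: int and q :: nat where aq: "1 \<le> q" "coprime a (int q)" "0 \<le> a" "a \<le> int q"
          "q * (1 + x * \<bar>\<theta> - a / q\<bar>) \<le> 3 * sqrt x"
        using ex_rational_approx[OF _ \<theta>] elim by metis
      define Q where "Q = q * (1 + x * \<bar>\<theta> - a / q\<bar>)"
      have Q3: "Q \<le> 3 * sqrt x" using aq by (simp add: Q_def)
      have "1 * 1 \<le> Q" unfolding Q_def using aq elim by (intro mult_mono) auto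
      then have Q1: "Q \<ge> 1" by simp
      have QJ: "2 * Q * y x \<le> 2 ^ J"
      proof -
        have "2 * Q * y x \<le> 2 * (3 * sqrt x) * x powr (e / 6)"
          using Q3 Q1 elim by (intro mult_mono) auto
        also have "\<dots> \<le> x powr 2" using elim by simp
        also have "\<dots> = 2 powr (2 * log 2 x)"
          using elim by (simp add: powr_def log_def)
        also have "\<dots> \<le> 2 powr real J" using J by (intro powr_mono) auto
        finally show ?thesis by (simp add: powr_realpow)
      qed
      have x0: "x > 0" using elim by simp
      have triv: "real (card (smooth_set U (y x))) \<le> 1 * U powr 1" if "U > 0" for U
        using smooth_count_le[of U "y x"] that by (simp add: smooth_count_def)
      have up: "real (card (smooth_set U (y x))) \<le> x powr e * U powr \<sigma>" if "U > 0" for U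
        using elim that by (simp add: \<sigma>_def)
      have xe1: "x powr e \<ge> 1" using elim assms(3) by (intro ge_one_powr_ge_zero) auto
      have "norm (smooth_exp_sum \<theta> x (y x))
          \<le> 45 * real (J + 1) * 1\<^sup>2 * y x ^ 3 * x powr 1 * Q powr (1 / 2 - 1)"
        by (rule norm_smooth_exp_sum_le[OF triv _ aq(1,2) _ _ _ x0 Q_def Q3 QJ]) (use elim in auto)
      also have "\<dots> = (45 * real (J + 1) * y x ^ 3) * (x * Q powr - (1 / 2))"
        using elim by simp
      also have "\<dots> \<le> x powr e * (x * Q powr - (1 / 2))"
        using elim by (intro mult_right_mono const) auto
      also have "\<dots> = x powr (1 + e) * Q powr - (1 / 2)"
        using elim by (simp add: powr_add)
      finally have b1: "norm (smooth_exp_sum \<theta> x (y x)) \<le> x powr (1 + e) * Q powr - (1 / 2)" .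
      have "norm (smooth_exp_sum \<theta> x (y x))
          \<le> 45 * real (J + 1) * (x powr e)\<^sup>2 * y x ^ 3 * x powr \<sigma> * Q powr (1 / 2 - \<sigma>)"
        by (rule norm_smooth_exp_sum_le[OF up _ aq(1,2) \<sigma> xe1 x0 Q_def Q3 QJ]) (use elim in auto)
      also have "\<dots> = (45 * real (J + 1) * y x ^ 3) * ((x powr e)\<^sup>2 * x powr \<sigma> * Q powr (1 / 2 - \<sigma>))"
        by simp
      also have "\<dots> \<le> x powr e * ((x powr e)\<^sup>2 * x powr \<sigma> * Q powr (1 / 2 - \<sigma>))"
        by (intro mult_right_mono const) auto
      also have "\<dots> = x powr (1 - 1 / K + 4 * e) * Q powr (1 / 2 - \<sigma>)"
        by (simp add: \<sigma>_def power2_eq_square flip: powr_add mult.assoc) (simp add: algebra_simps)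
      also have "\<dots> \<le> x powr (1 - 1 / K + 4 * e) * Q powr - ((1 - 3 * (1 / K)) / 2)"
      proof (intro mult_left_mono powr_mono)
        \<comment> \<open>The exponent obtained is -1/2 + 1/K - e, which is below -1/2 + (3/2) /
          K.\<close>
        have "(1 - 3 * (1 / K)) / 2 = 1 / 2 - 3 / 2 * (1 / K)" by (simp add: diff_divide_distrib)
        then show "1 / 2 - \<sigma> \<le> - ((1 - 3 * (1 / K)) / 2)"
          unfolding \<sigma>_def using assms(3) \<open>1 / K > 0\<close> by linarith
      qed (use Q1 in auto)
      finally have b2: "norm (smooth_exp_sum \<theta> x (y x))
          \<le> x powr (1 - 1 / K + 4 * e) * Q powr - ((1 - 3 * (1 / K)) / 2)" .
      show "\<exists>(a :: int) (q :: nat) Q.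
          1 \<le> q \<and> 0 \<le> a \<and> a \<le> int q \<and> Q = q * (1 + x * \<bar>\<theta> - a / q\<bar>) \<and>
          norm (smooth_exp_sum \<theta> x (y x)) \<le> x powr (1 + e) * Q powr - (1 / 2) \<and>
          norm (smooth_exp_sum \<theta> x (y x)) \<le> x powr (1 - 1 / K + 4 * e) * Q powr - ((1 - 3 * (1 / K)) / 2)"
        using aq b1 b2 Q_def by blast
    qed
  qed
qed

section \<open>Splitting by the size of Q and balancing the exponents\<close>

theorem theorem1p2:
  fixes K \<rho> \<kappa> \<beta> \<eta> :: real and y :: "real \<Rightarrow> real"
  assumes "K > 3" and "\<rho> > 2"
    and "log_power_growth K y"
    and "\<kappa> = 1 / K"
    and "\<beta> = (1 - 3 * \<kappa>) / 4"
    and "\<eta> = \<kappa> * (\<rho> - 1) / (2 + 3 * \<kappa> * \<rho>)"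
    and "1 / 2 < \<beta> * \<rho>" and "\<beta> * \<rho> < 1"
    and "2 < \<rho>" and "\<rho> < 2 * K + 4"
  shows "\<forall>\<epsilon>>0. \<forall>\<^sub>F x in at_top.
           smooth_moment \<rho> x (y x) \<le>
             real (smooth_count x (y x)) powr (1 + \<epsilon>) *
             (x powr (3 * (\<rho> - 2) / 4) + x powr ((\<rho> - 2) * (1 - \<eta>)))"
proof (intro allI impI)
  fix \<epsilon> :: real assume \<epsilon>: "\<epsilon> > 0"
  have "1 / K < 1 / 3" using assms(1) by (intro divide_strict_left_mono) auto
  then have \<kappa>: "0 < \<kappa>" "\<kappa> < 1 / 3" using assms(1,4) by auto
  have \<eta>0: "\<eta> \<ge> 0" unfolding assms(6) using \<kappa> assms(2) by (intro divide_nonneg_nonneg) auto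
  \<comment> \<open>This is the balance: at Z = x^(2 \<eta>) the second bound contributes x^((1 -
    \<kappa>) \<rho> - 1 + 2 \<eta> (2 - 2 \<beta> \<rho>)), whose exponent equals 1 - \<kappa> +
    (\<rho> - 2) (1 - \<eta>) exactly under this identity.\<close>
  have \<eta>_eq: "\<eta> * (2 + 3 * \<kappa> * \<rho>) = \<kappa> * (\<rho> - 1)"
  proof -
    have "2 + 3 * \<kappa> * \<rho> > 0" using \<kappa> assms(2) by (simp add: add_pos_pos)
    then show ?thesis unfolding assms(6) by simp
  qed
  \<comment> \<open>\<open>w\<close> counts the losses in units of e: 4 \<rho> from the pointwise
    bound, 2 from the width of a layer, 4 from the lower bound for \<Psi>, and 1 for the number of
    layers.\<close>
  define w where "w = 4 * \<rho> + 7"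
  have w: "w > 0" using assms(2) by (simp add: w_def)
  \<comment> \<open>The three bounds give x^(e w) <= x^(\<epsilon> / 2), e < 1/K, and 1 - \<kappa> -
    4 e >= 1/2; the last one yields \<Psi> >= sqrt x, so \<Psi>^\<epsilon> absorbs x^(\<epsilon> /
    2).\<close>
  define e where "e = Min {\<epsilon> / (2 * w), \<kappa> / 2, 1 / 24}"
  have e: "e \<le> \<epsilon> / (2 * w)" "e \<le> \<kappa> / 2" "e \<le> 1 / 24" "0 < e"
    using \<epsilon> w \<kappa> by (auto simp: e_def)
  define A where "A = (\<rho> - 2) * (1 - \<eta>)"
  define J where "J = nat \<lfloor>2 * \<eta> / e\<rfloor>"
  define b where "b x = x powr (1 + e - \<eta>)" for x :: real
  \<comment> \<open>In layer j, where Q lies between x^(j e) and x^((j + 1) e), \<open>c\<close>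
    uses the lower end to bound the sum and \<open>Z\<close> the upper end to bound the
    measure.\<close>
  define c where "c x j = x powr (1 - \<kappa> + 4 * e - 2 * \<beta> * (real j * e))" for x :: real and j :: nat
  define Z where "Z x j = x powr ((real j + 1) * e)" for x :: real and j :: nat
  have "e < \<kappa>" "4 * e < 1 - \<kappa>" using e(2,3) \<kappa> by linarith+
  then have e1: "e < 1 / K" and e2: "4 * e < 1 - 1 / K" by (simp_all only: assms(4))
  have K3: "K \<ge> 3" and K2: "K \<ge> 2" using assms(1) by auto
  have asymp: "\<forall>\<^sub>F x :: real in at_top. 1 + 4 * (real J + 1) \<le> x powr e"
    using e(4) by real_asymp
  have \<beta>: "2 - 2 * (\<beta> * \<rho>) > 0" using assms(8) by simp
  show "\<forall>\<^sub>F x in at_top. smooth_moment \<rho> x (y x) \<le>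
             real (smooth_count x (y x)) powr (1 + \<epsilon>) *
             (x powr (3 * (\<rho> - 2) / 4) + x powr ((\<rho> - 2) * (1 - \<eta>)))"
    using smooth_exp_sum_bounds[OF assms(3) K3 e(4) e1]
      smooth_count_lower[OF assms(3) K2 e(4) e2] asymp eventually_gt_at_top[of 1]
  proof eventually_elim
    case (elim x)
    define S where "S \<theta> = norm (smooth_exp_sum \<theta> x (y x))" for \<theta>
    define \<Psi> where "\<Psi> = real (smooth_count x (y x))"
    have x1: "x > 1" using elim by simp
    have \<Psi>: "x powr (1 - \<kappa> - 4 * e) \<le> \<Psi>" using elim assms(4) by (simp add: \<Psi>_def)
    then have \<Psi>0: "\<Psi> > 0" using x1 by (smt (verit) powr_gt_zero)
    have cover: "S \<theta> \<le> b x \<or> (\<exists>j\<le>J. S \<theta> \<le> c x j \<and> 1 \<le> arc_count x (Z x j) \<theta>)"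
      if \<theta>: "0 \<le> \<theta>" "\<theta> \<le> 1" for \<theta>
    proof -
      obtain a :: int and q :: nat and Q where aq: "1 \<le> q" "0 \<le> a" "a \<le> int q"
        and Q: "Q = q * (1 + x * \<bar>\<theta> - a / q\<bar>)"
        and b1: "S \<theta> \<le> x powr (1 + e) * Q powr - (1 / 2)"
        and b2: "S \<theta> \<le> x powr (1 - \<kappa> + 4 * e) * Q powr - ((1 - 3 * \<kappa>) / 2)"
        using elim(1) \<theta> unfolding S_def assms(4) by metis
      have "1 * 1 \<le> 1 + x * \<bar>\<theta> - a / q\<bar>" using x1 by simp
      then have "real q * (1 * 1) \<le> Q" unfolding Q by (intro mult_left_mono) auto
      then have qQ: "real q \<le> Q" by simp
      then have Q1: "Q \<ge> 1" using aq by linarith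
      show ?thesis
      proof (cases "Q \<le> x powr (2 * \<eta>)")
        case False
        have "Q powr - (1 / 2) \<le> (x powr (2 * \<eta>)) powr - (1 / 2)"
          using False x1 by (intro powr_mono2') auto
        then have "S \<theta> \<le> x powr (1 + e) * (x powr (2 * \<eta>)) powr - (1 / 2)"
          using b1 by (smt (verit) mult_left_mono powr_ge_zero)
        also have "\<dots> = b x" by (simp add: b_def powr_powr flip: powr_add)
        finally show ?thesis by simp
      next
        case True
        define l where "l = log x Q"
        have Ql: "Q = x powr l" using x1 Q1 by (simp add: l_def)
        have l0: "l \<ge> 0" using x1 Q1 by (simp add: l_def)
        have l2: "l \<le> 2 * \<eta>" using True x1 unfolding Ql by simp
        define j where "j = nat \<lfloor>l / e\<rfloor>"
        have "l / e \<ge> 0" using l0 e by simp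
        then have "real j \<le> l / e" "l / e \<le> real j + 1" unfolding j_def by linarith+
        then have j: "real j * e \<le> l" "l \<le> (real j + 1) * e" using e by (simp_all add: field_simps)
        have "l / e \<le> 2 * \<eta> / e" using l2 e by (simp add: divide_right_mono)
        then have jJ: "j \<le> J" unfolding j_def J_def by (intro nat_mono floor_mono)
        have "S \<theta> \<le> x powr (1 - \<kappa> + 4 * e) * (x powr l) powr - ((1 - 3 * \<kappa>) / 2)"
          using b2 by (simp add: Ql)
        also have "\<dots> = x powr (1 - \<kappa> + 4 * e - 2 * \<beta> * l)"
        proof -
          have "1 - \<kappa> + 4 * e + l * - ((1 - 3 * \<kappa>) / 2) = 1 - \<kappa> + 4 * e - 2 * \<beta> * l"
            unfolding assms(5) by (simp add: field_simps)
          then show ?thesis by (simp only: powr_powr flip: powr_add)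
        qed
        also have "\<dots> \<le> c x j"
        proof -
          have "2 * \<beta> * (real j * e) \<le> 2 * \<beta> * l"
            using j \<kappa> assms(5) by (intro mult_left_mono) auto
          then show ?thesis unfolding c_def using x1 by (intro powr_mono) auto
        qed
        finally have "S \<theta> \<le> c x j" .
        moreover have QZ: "Q \<le> Z x j" unfolding Ql Z_def using j x1 by (intro powr_mono) auto
        have "1 \<le> arc_count x (Z x j) \<theta>"
        proof (rule arc_count_ge_one[OF aq(1) _ aq(2,3)])
          show "real q \<le> Z x j" using qQ QZ by linarith
          have "\<bar>\<theta> - a / q\<bar> * (q * x) \<le> Q" unfolding Q by (simp add: algebra_simps)
          then have "\<bar>\<theta> - a / q\<bar> * (q * x) \<le> Z x j" using QZ by linarith
          then show "\<bar>\<theta> - a / q\<bar> \<le> Z x j / (q * x)"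
            using aq(1) x1 by (subst pos_le_divide_eq) auto
        qed
        ultimately show ?thesis using jJ by blast
      qed
    qed
    have "smooth_moment \<rho> x (y x) \<le> b x powr (\<rho> - 2) * \<Psi>
        + (\<Sum>j\<le>J. c x j powr \<rho> * (4 * (Z x j)\<^sup>2 / x))"
      unfolding \<Psi>_def
      by (rule smooth_moment_le_layers) (use assms(2) x1 cover in \<open>auto simp: Z_def S_def\<close>)
    also have "b x powr (\<rho> - 2) * \<Psi> \<le> \<Psi> * x powr (A + e * (w - 1))"
    proof -
      have "b x powr (\<rho> - 2) = x powr (A + e * (\<rho> - 2))"
        unfolding b_def A_def powr_powr by (simp add: algebra_simps)
      also have "\<dots> \<le> x powr (A + e * (w - 1))"
        using x1 e assms(2) by (intro powr_mono add_left_mono mult_left_mono) (auto simp: w_def)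
      finally show ?thesis using \<Psi>0 by (simp add: mult.commute)
    qed
    also have "(\<Sum>j\<le>J. c x j powr \<rho> * (4 * (Z x j)\<^sup>2 / x)) \<le> (\<Sum>j\<le>J. 4 * (\<Psi> * x powr (A + e * (w - 1))))"
    proof (rule sum_mono)
      fix j assume "j \<in> {..J}"
      then have "j \<le> nat \<lfloor>2 * \<eta> / e\<rfloor>" by (simp add: J_def)
      moreover have "0 \<le> 2 * \<eta> / e" using \<eta>0 e by simp
      ultimately have "real j \<le> 2 * \<eta> / e" by linarith
      then have je: "real j * e \<le> 2 * \<eta>" using e by (simp add: field_simps)
      have "c x j powr \<rho> * ((Z x j)\<^sup>2 / x)
          = x powr ((1 - \<kappa> + 4 * e - 2 * \<beta> * (real j * e)) * \<rho> + (real j + 1) * e * 2 - 1)"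
      proof -
        have "(x powr t)\<^sup>2 = x powr (t * 2)" for t
          by (simp add: power2_eq_square mult_2_right flip: powr_add)
        then show ?thesis
          unfolding c_def Z_def powr_powr using x1 by (simp add: powr_add powr_diff)
      qed
      also have "\<dots> \<le> x powr ((1 - \<kappa> - 4 * e) + (A + e * (w - 1)))"
      proof (intro powr_mono)
        \<comment> \<open>As \<beta> \<rho> < 1, the exponent grows with j, so the worst layer is
          the top one, j e <= 2 \<eta>, where the choice of \<eta> applies.\<close>
        have "(real j * e) * (2 - 2 * (\<beta> * \<rho>)) \<le> 2 * \<eta> * (2 - 2 * (\<beta> * \<rho>))"
          using je \<beta> by (intro mult_right_mono) auto
        moreover have "2 * \<eta> * (2 - 2 * (\<beta> * \<rho>)) = \<eta> * (2 + 3 * \<kappa> * \<rho>) - (\<rho> - 2) * \<eta>"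
          unfolding assms(5) by (simp add: field_simps)
        ultimately have "(real j * e) * (2 - 2 * (\<beta> * \<rho>)) \<le> \<kappa> * (\<rho> - 1) - (\<rho> - 2) * \<eta>"
          unfolding \<eta>_eq by simp
        then show "(1 - \<kappa> + 4 * e - 2 * \<beta> * (real j * e)) * \<rho> + (real j + 1) * e * 2 - 1
            \<le> (1 - \<kappa> - 4 * e) + (A + e * (w - 1))"
          unfolding A_def w_def by (simp add: algebra_simps)
      qed (use x1 in simp)
      also have "\<dots> = x powr (1 - \<kappa> - 4 * e) * x powr (A + e * (w - 1))" by (rule powr_add)
      also have "\<dots> \<le> \<Psi> * x powr (A + e * (w - 1))" using \<Psi> by (intro mult_right_mono) auto
      finally show "c x j powr \<rho> * (4 * (Z x j)\<^sup>2 / x) \<le> 4 * (\<Psi> * x powr (A + e * (w - 1)))"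
        by (simp add: mult.left_commute)
    qed
    also have "\<Psi> * x powr (A + e * (w - 1)) + (\<Sum>j\<le>J. 4 * (\<Psi> * x powr (A + e * (w - 1))))
        = (1 + 4 * (real J + 1)) * (\<Psi> * x powr (A + e * (w - 1)))"
      by (simp add: algebra_simps)
    also have "\<dots> \<le> x powr e * (\<Psi> * x powr (A + e * (w - 1)))"
      using elim(3) \<Psi>0 by (intro mult_right_mono) auto
    also have "\<dots> = \<Psi> * x powr (e * w) * x powr A"
      by (simp add: algebra_simps flip: powr_add)
    also have "\<dots> \<le> \<Psi> * \<Psi> powr \<epsilon> * x powr A"
    proof (intro mult_right_mono mult_left_mono)
      have "e * w \<le> \<epsilon> / 2" using e(1) w by (simp add: field_simps)
      then have "x powr (e * w) \<le> x powr (1 / 2 * \<epsilon>)" using x1 by (intro powr_mono) auto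
      also have "\<dots> = (x powr (1 / 2)) powr \<epsilon>" by (simp add: powr_powr)
      also have "\<dots> \<le> \<Psi> powr \<epsilon>"
      proof (intro powr_mono2)
        have "x powr (1 / 2) \<le> x powr (1 - \<kappa> - 4 * e)"
          using x1 \<kappa> e(3) by (intro powr_mono) auto
        then show "x powr (1 / 2) \<le> \<Psi>" using \<Psi> by linarith
      qed (use \<epsilon> in auto)
      finally show "x powr (e * w) \<le> \<Psi> powr \<epsilon>" .
    qed (use \<Psi>0 in auto)
    also have "\<dots> = \<Psi> powr (1 + \<epsilon>) * x powr A" using \<Psi>0 by (simp add: powr_add)
    also have "\<dots> \<le> \<Psi> powr (1 + \<epsilon>) * (x powr (3 * (\<rho> - 2) / 4) + x powr A)"
      by (intro mult_left_mono) auto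
    finally show ?case by (simp add: \<Psi>_def A_def)
  qed
qed

end
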